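(* Let $k$ be a field with $\mathrm{char}\,k\ne2$, let $a\in k^\times$ and $\varepsilon\in\{1,-1\}$, and let $G=\langle\tau,\lambda,\sigma\rangle\simeq A_4$ act on the rational function field $k(x_1,x_2,x_3)$ by the $k$-automorphisms $\tau: x_1\mapsto \frac{a}{x_1},\ x_2\mapsto\varepsilon\frac{a}{x_2},\ x_3\mapsto\varepsilon x_3$; $\lambda: x_1\mapsto\varepsilon\frac{a}{x_1},\ x_2\mapsto\varepsilon x_2,\ x_3\mapsto\frac{a}{x_3}$; $\sigma: x_1\mapsto x_2,\ x_2\mapsto x_3,\ x_3\mapsto x_1$. (1) If $\varepsilon=1$, then $k(x_1,x_2,x_3)^G$ is $k$-rational. (2) If $\varepsilon=-1$ and $[k(\sqrt a,\sqrt{-1}):k]\le2$, then $k(x_1,x_2,x_3)^G$ is $k$-rational.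
   Context: $A_4$ is the alternating group of degree $4$. A field is $k$-rational if it is purely transcendental over $k$. *)

theory Defs
  imports Main
begin

definition subfield :: "'a::field set \<Rightarrow> bool" where
  "subfield S \<longleftrightarrow> 0 \<in> S \<and> 1 \<in> S \<and> (\<forall>x\<in>S. \<forall>y\<in>S. x + y \<in> S \<and> x * y \<in> S)
     \<and> (\<forall>x\<in>S. - x \<in> S \<and> inverse x \<in> S)"

definition gen_field :: "'a::field set \<Rightarrow> 'a set \<Rightarrow> 'a set" where
  "gen_field k T = \<Inter>{S. subfield S \<and> k \<subseteq> S \<and> T \<subseteq> S}"

definition alg_indep :: "'a::field set \<Rightarrow> 'a list \<Rightarrow> bool" where
  "alg_indep k t \<longleftrightarrow>
     (\<forall>(M :: nat list set) (c :: nat list \<Rightarrow> 'a).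
        finite M \<and> (\<forall>e\<in>M. length e = length t) \<and> (\<forall>e\<in>M. c e \<in> k)
        \<and> (\<Sum>e\<in>M. c e * (\<Prod>i<length t. (t ! i) ^ (e ! i))) = 0
        \<longrightarrow> (\<forall>e\<in>M. c e = 0))"

definition k_rational :: "'a::field set \<Rightarrow> 'a set \<Rightarrow> bool" where
  "k_rational k F \<longleftrightarrow> (\<exists>t. set t \<subseteq> F \<and> alg_indep k t \<and> gen_field k (set t) = F)"

definition k_aut :: "'a::field set \<Rightarrow> ('a \<Rightarrow> 'a) \<Rightarrow> bool" where
  "k_aut k f \<longleftrightarrow> bij f \<and> (\<forall>x y. f (x + y) = f x + f y \<and> f (x * y) = f x * f y)
     \<and> (\<forall>c\<in>k. f c = c)"

definition emb_on :: "'a::field set \<Rightarrow> ('a \<Rightarrow> 'b::field) \<Rightarrow> bool" where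
  "emb_on k \<phi> \<longleftrightarrow> \<phi> 1 = 1 \<and> (\<forall>x\<in>k. \<forall>y\<in>k. \<phi> (x + y) = \<phi> x + \<phi> y \<and> \<phi> (x * y) = \<phi> x * \<phi> y)"

definition dim_le2 :: "'a::field set \<Rightarrow> 'a set \<Rightarrow> bool" where
  "dim_le2 k V \<longleftrightarrow> (\<exists>b1 b2. \<forall>y\<in>V. \<exists>c1\<in>k. \<exists>c2\<in>k. y = c1 * b1 + c2 * b2)"

end

(* Let V be the Klein four group generated by tau and lam. Its fixed field turns out to be generated
   by three elements that sig permutes cyclically, and the fixed field of a cyclic permutation of
   three independent variables is rational (Masuda).

   For eps = 1 the substitution y = (x - s) / (x + s) with s^2 = a makes V act by even sign
   changes, with invariants y2 y3 / y1 and so on. Moving these back by the inverse substitution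
   yields generators that do not involve s.

   For eps = -1 the degree condition says that -1, a or -a is a square in k. In each case there
   are p_j, q_j in k(x_j) with p_j^2 + q_j^2 = c, where c in k is a sum of two squares, on which V
   acts by sign changes. From them one obtains V-invariant points v1, v2, v3 of the plane with
   R(v1,v2) = R(v2,v3) = R(v3,v1) = c for a bilinear form R, and since R(v,v) = c has a
   k-rational solution, projecting from it makes these equations linear.

   Algebraic independence of the generators follows from the Steinitz exchange property of
   algebraic closure, and denominators are seen to be nonzero by specialising to x1 = x2 = x3. *)
theory Submission
  imports Defs "HOL-Computational_Algebra.Polynomial"
begin


section \<open>Subfields\<close>

text \<open>For \<open>eps = -1\<close> all three cases come from one identity, (x^2 + a)^2 = (x^2 -
  a)^2 + 4 a x^2. Under x -> -x and x -> a/x the functions x^2 + a, x^2 - a and x only change sign,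
  up to a common factor. Dividing by x^2, (x^2 + a)^2 or (x^2 - a)^2 therefore gives a conic on
  which the Klein four group acts by signs, and a square root in k of -1, a or -a, respectively,
  turns this conic into p^2 + q^2 = c.

  The signs are arranged so that p1 and q2 belong to the same character of V, and likewise p2, q3
  and p3, q1. Hence p1 q2, p2 q3, p3 q1, p1 p2 p3 and q1 q2 q3 are invariant. Being five functions
  in a field of transcendence degree 3, they are dependent; the plane points v_j and then the slopes
  of the lines through them serve to replace them by three generators that the rotation permutes.

  Both fixed fields are identified without Galois theory: a field F of invariants is the whole fixed
  field once the ambient field is F(t1, t2), with t1^2 and t2^2 in F and with elements of V that
  separate the signs of t1 and t2.\<close>

lemma
  assumes "subfield F"
  shows subfield_0 [simp]: "0 \<in> F" and subfield_1 [simp]: "1 \<in> F"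
    and subfield_add: "x \<in> F \<Longrightarrow> y \<in> F \<Longrightarrow> x + y \<in> F"
    and subfield_mult: "x \<in> F \<Longrightarrow> y \<in> F \<Longrightarrow> x * y \<in> F"
    and subfield_uminus: "x \<in> F \<Longrightarrow> - x \<in> F"
    and subfield_inverse: "x \<in> F \<Longrightarrow> inverse x \<in> F"
    and subfield_diff: "x \<in> F \<Longrightarrow> y \<in> F \<Longrightarrow> x - y \<in> F"
    and subfield_divide: "x \<in> F \<Longrightarrow> y \<in> F \<Longrightarrow> x / y \<in> F"
proof -
  show 0: "0 \<in> F" "1 \<in> F" using assms by (auto simp: subfield_def)
  show a: "x \<in> F \<Longrightarrow> y \<in> F \<Longrightarrow> x + y \<in> F" for x y using assms by (auto simp: subfield_def)
  show m: "x \<in> F \<Longrightarrow> y \<in> F \<Longrightarrow> x * y \<in> F" for x y using assms by (auto simp: subfield_def)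
  show u: "x \<in> F \<Longrightarrow> - x \<in> F" for x using assms by (auto simp: subfield_def)
  show i: "x \<in> F \<Longrightarrow> inverse x \<in> F" for x using assms by (auto simp: subfield_def)
  show "x \<in> F \<Longrightarrow> y \<in> F \<Longrightarrow> x - y \<in> F" using a[of x "- y"] u by simp
  show "x \<in> F \<Longrightarrow> y \<in> F \<Longrightarrow> x / y \<in> F" using m[of x "inverse y"] i by (simp add: divide_inverse)
qed

lemma subfield_power: "subfield F \<Longrightarrow> x \<in> F \<Longrightarrow> x ^ n \<in> F"
  by (induction n) (auto intro: subfield_mult)

lemma subfield_of_nat: "subfield F \<Longrightarrow> of_nat n \<in> F"
  by (induction n) (auto intro: subfield_add)

lemma subfield_numeral: "subfield F \<Longrightarrow> numeral n \<in> F"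
  using subfield_of_nat[of F "numeral n"] by simp

lemma subfield_sum: "subfield F \<Longrightarrow> (\<And>x. x \<in> A \<Longrightarrow> f x \<in> F) \<Longrightarrow> sum f A \<in> F"
  by (induction A rule: infinite_finite_induct) (auto intro: subfield_add)

lemma subfield_prod: "subfield F \<Longrightarrow> (\<And>x. x \<in> A \<Longrightarrow> f x \<in> F) \<Longrightarrow> prod f A \<in> F"
  by (induction A rule: infinite_finite_induct) (auto intro: subfield_mult)

lemmas subfield_closed = subfield_add subfield_mult subfield_uminus subfield_inverse
  subfield_diff subfield_divide subfield_power subfield_numeral subfield_0 subfield_1

lemma subfield_gen_field: "subfield (gen_field k T)"
  unfolding gen_field_def subfield_def[of "\<Inter> _"] by (auto intro: subfield_closed)

lemma gen_field_base: "x \<in> k \<Longrightarrow> x \<in> gen_field k T"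
  by (auto simp: gen_field_def)

lemma gen_field_gen: "x \<in> T \<Longrightarrow> x \<in> gen_field k T"
  by (auto simp: gen_field_def)

lemma gen_field_least: "subfield S \<Longrightarrow> k \<subseteq> S \<Longrightarrow> T \<subseteq> S \<Longrightarrow> gen_field k T \<subseteq> S"
  by (auto simp: gen_field_def)

lemma gen_field_mono: "T \<subseteq> T' \<Longrightarrow> gen_field k T \<subseteq> gen_field k T'"
  by (auto simp: gen_field_def)

lemma gen_field_empty: "subfield k \<Longrightarrow> gen_field k {} = k"
  by (auto simp: gen_field_def)

lemma gen_field_gen_field: "gen_field (gen_field k S) T = gen_field k (S \<union> T)"
proof
  show "gen_field (gen_field k S) T \<subseteq> gen_field k (S \<union> T)"
    by (intro gen_field_least subfield_gen_field) (auto intro: gen_field_base gen_field_gen)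
  show "gen_field k (S \<union> T) \<subseteq> gen_field (gen_field k S) T"
  proof (intro gen_field_least subfield_gen_field)
    show "k \<subseteq> gen_field (gen_field k S) T" by (meson gen_field_base subsetI)
    show "S \<union> T \<subseteq> gen_field (gen_field k S) T" by (meson Un_iff gen_field_base gen_field_gen subsetI)
  qed
qed

section \<open>Linear dependence over a subfield\<close>

text \<open>Gaussian elimination, by induction on the equations \<open>B\<close>: an unknown
  \<open>i0\<close> with nonzero coefficient in the equation \<open>b0\<close> is eliminated from
  the others. Sums over index sets are used because the scalars form a subset of the field, not a
  type.\<close>

lemma homogeneous_system_nontrivial_solution:
  fixes f :: "'i \<Rightarrow> 'b \<Rightarrow> 'a::field"
  assumes F: "subfield F" and "finite B" "finite I" "card B < card I"
    and "\<And>i b. i \<in> I \<Longrightarrow> b \<in> B \<Longrightarrow> f i b \<in> F"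
  shows "\<exists>a. (\<forall>i\<in>I. a i \<in> F) \<and> (\<exists>i\<in>I. a i \<noteq> 0) \<and> (\<forall>b\<in>B. (\<Sum>i\<in>I. a i * f i b) = 0)"
  using assms(2-)
proof (induction B arbitrary: I f rule: finite_induct)
  case empty
  then obtain i where "i \<in> I" by fastforce
  then show ?case using F by (intro exI[of _ "\<lambda>_. 1"]) auto
next
  case (insert b0 B)
  show ?case
  proof (cases "\<forall>i\<in>I. f i b0 = 0")
    case True
    have "card B < card I" using insert by auto
    with insert.IH[of I f] insert.prems obtain a where
      "\<forall>i\<in>I. a i \<in> F" "\<exists>i\<in>I. a i \<noteq> 0" "\<forall>b\<in>B. (\<Sum>i\<in>I. a i * f i b) = 0" by blast
    then show ?thesis using True by (intro exI[of _ a]) auto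
  next
    case False
    then obtain i0 where i0: "i0 \<in> I" "f i0 b0 \<noteq> 0" by blast
    define J where "J = I - {i0}"
    define g where "g = (\<lambda>i b. f i b - f i b0 / f i0 b0 * f i0 b)"
    have fin: "finite J" "i0 \<notin> J" and I: "I = insert i0 J"
      using i0 insert.prems by (auto simp: J_def)
    have "card B < card J" using insert fin I by auto
    moreover have "g i b \<in> F" if "i \<in> J" "b \<in> B" for i b
      unfolding g_def using that i0 insert.prems(3) I F by (auto intro!: subfield_closed)
    ultimately obtain a where a: "\<forall>i\<in>J. a i \<in> F" "\<exists>i\<in>J. a i \<noteq> 0"
      "\<forall>b\<in>B. (\<Sum>i\<in>J. a i * g i b) = 0"
      using insert.IH[of J g] fin by blast
    define c where "c = - (\<Sum>i\<in>J. a i * f i b0) / f i0 b0"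
    define a' where "a' = a(i0 := c)"
    have "c \<in> F" unfolding c_def using F a(1) i0 insert.prems(3) I
      by (auto intro!: subfield_closed subfield_sum)
    have sum: "(\<Sum>i\<in>I. a' i * f i b) = c * f i0 b + (\<Sum>i\<in>J. a i * f i b)" for b
      unfolding I using fin by (simp add: a'_def, intro sum.cong) auto
    have "(\<Sum>i\<in>J. a i * f i b) = (\<Sum>i\<in>J. a i * g i b) + (\<Sum>i\<in>J. a i * f i b0) / f i0 b0 * f i0 b" for b
      by (simp add: g_def sum_distrib_right sum_divide_distrib flip: sum.distrib)
         (simp add: algebra_simps)
    note expand = this
    have "(\<Sum>i\<in>I. a' i * f i b) = 0" if "b \<in> insert b0 B" for b
    proof (cases "b = b0")
      case True
      then show ?thesis using i0(2) unfolding sum by (simp add: c_def)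
    next
      case False
      then have "(\<Sum>i\<in>J. a i * g i b) = 0" using that a(3) by blast
      then show ?thesis unfolding sum expand[of b] c_def by simp
    qed
    moreover have "\<forall>i\<in>I. a' i \<in> F" using a(1) \<open>c \<in> F\<close> by (auto simp: a'_def I)
    moreover have "\<exists>i\<in>I. a' i \<noteq> 0" using a(2) fin(2) by (auto simp: a'_def I)
    ultimately show ?thesis by blast
  qed
qed

definition fspan :: "'a::field set \<Rightarrow> 'a set \<Rightarrow> 'a set" where
  "fspan F B = {y. \<exists>f. (\<forall>b\<in>B. f b \<in> F) \<and> y = (\<Sum>b\<in>B. f b * b)}"

lemma fspan_dependent:
  assumes F: "subfield F" and B: "finite B" and I: "finite I" "card B < card I"
    and z: "\<And>i. i \<in> I \<Longrightarrow> z i \<in> fspan F B"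
  shows "\<exists>a. (\<forall>i\<in>I. a i \<in> F) \<and> (\<exists>i\<in>I. a i \<noteq> 0) \<and> (\<Sum>i\<in>I. a i * z i) = 0"
proof -
  have "\<forall>i\<in>I. \<exists>f. (\<forall>b\<in>B. f b \<in> F) \<and> z i = (\<Sum>b\<in>B. f b * b)"
    using z by (auto simp: fspan_def)
  then obtain f where f: "\<And>i b. i \<in> I \<Longrightarrow> b \<in> B \<Longrightarrow> f i b \<in> F"
    "\<And>i. i \<in> I \<Longrightarrow> z i = (\<Sum>b\<in>B. f i b * b)"
    by metis
  obtain a where a: "\<forall>i\<in>I. a i \<in> F" "\<exists>i\<in>I. a i \<noteq> 0" "\<forall>b\<in>B. (\<Sum>i\<in>I. a i * f i b) = 0"
    using homogeneous_system_nontrivial_solution[OF F B I, of f] f(1) by blast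
  have "(\<Sum>i\<in>I. a i * z i) = (\<Sum>i\<in>I. \<Sum>b\<in>B. a i * f i b * b)"
    by (simp add: f(2) sum_distrib_left mult.assoc)
  also have "\<dots> = (\<Sum>b\<in>B. (\<Sum>i\<in>I. a i * f i b) * b)"
    by (subst sum.swap) (simp add: sum_distrib_right)
  also have "\<dots> = 0" using a(3) by simp
  finally show ?thesis using a by blast
qed

lemma fspan_base:
  assumes "subfield F" "finite B" "b \<in> B" shows "b \<in> fspan F B"
proof -
  have "(\<Sum>x\<in>B. (if x = b then 1 else 0) * x) = (\<Sum>x\<in>B. if x = b then x else 0)"
    by (intro sum.cong) auto
  also have "\<dots> = b" using assms by simp
  finally show ?thesis using assms(1)
    unfolding fspan_def by (intro CollectI exI[of _ "\<lambda>x. if x = b then 1 else 0"]) auto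
qed

lemma fspan_0: "subfield F \<Longrightarrow> 0 \<in> fspan F B"
  unfolding fspan_def by (rule CollectI, rule exI[of _ "\<lambda>x. 0"]) auto

lemma fspan_add: assumes "subfield F" "x \<in> fspan F B" "y \<in> fspan F B" shows "x + y \<in> fspan F B"
proof -
  obtain f g where "\<forall>b\<in>B. f b \<in> F" "x = (\<Sum>b\<in>B. f b * b)" "\<forall>b\<in>B. g b \<in> F" "y = (\<Sum>b\<in>B. g b * b)"
    using assms(2,3) by (auto simp: fspan_def)
  then show ?thesis unfolding fspan_def using assms(1)
    by (intro CollectI exI[of _ "\<lambda>b. f b + g b"]) (auto simp: distrib_right sum.distrib intro: subfield_add)
qed

lemma fspan_scale: assumes "subfield F" "c \<in> F" "x \<in> fspan F B" shows "c * x \<in> fspan F B"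
proof -
  obtain f where "\<forall>b\<in>B. f b \<in> F" "x = (\<Sum>b\<in>B. f b * b)"
    using assms(3) by (auto simp: fspan_def)
  then show ?thesis unfolding fspan_def using assms(1,2)
    by (intro CollectI exI[of _ "\<lambda>b. c * f b"]) (auto simp: sum_distrib_left mult.assoc intro: subfield_mult)
qed

lemma fspan_sum: "subfield F \<Longrightarrow> (\<And>i. i \<in> I \<Longrightarrow> f i \<in> fspan F B) \<Longrightarrow> sum f I \<in> fspan F B"
  by (induction I rule: infinite_finite_induct) (auto intro: fspan_add fspan_0)

lemma fspan_mult_closed:
  assumes "x \<in> fspan F B" and F: "subfield F" and "\<And>b. b \<in> B \<Longrightarrow> y * b \<in> fspan F B'"
  shows "y * x \<in> fspan F B'"
proof -
  obtain f where f: "\<forall>b\<in>B. f b \<in> F" "x = (\<Sum>b\<in>B. f b * b)"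
    using assms(1) by (auto simp: fspan_def)
  have "y * x = (\<Sum>b\<in>B. f b * (y * b))" by (simp add: f sum_distrib_left algebra_simps)
  also have "\<dots> \<in> fspan F B'" using f(1) assms(3)
    by (intro fspan_sum[OF F], intro fspan_scale[OF F, of _ "y * _"]) auto
  finally show ?thesis .
qed

section \<open>Algebraic elements\<close>

definition polys_over :: "'a::field set \<Rightarrow> 'a poly set" where
  "polys_over F = {p. \<forall>i. coeff p i \<in> F}"

lemma polys_over_0: "subfield F \<Longrightarrow> 0 \<in> polys_over F"
  by (simp add: polys_over_def)

lemma polys_over_pCons: "pCons c p \<in> polys_over F \<longleftrightarrow> c \<in> F \<and> p \<in> polys_over F"
  unfolding polys_over_def by (auto simp: coeff_pCons split: nat.split)

lemma polys_over_add: "subfield F \<Longrightarrow> p \<in> polys_over F \<Longrightarrow> q \<in> polys_over F \<Longrightarrow> p + q \<in> polys_over F"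
  by (auto simp: polys_over_def intro: subfield_add)

lemma polys_over_mult: "subfield F \<Longrightarrow> p \<in> polys_over F \<Longrightarrow> q \<in> polys_over F \<Longrightarrow> p * q \<in> polys_over F"
  by (auto simp: polys_over_def coeff_mult intro!: subfield_sum subfield_mult)

lemma polys_over_uminus: "subfield F \<Longrightarrow> p \<in> polys_over F \<Longrightarrow> - p \<in> polys_over F"
  by (auto simp: polys_over_def intro: subfield_uminus)

definition alg_over :: "'a::field set \<Rightarrow> 'a \<Rightarrow> bool" where
  "alg_over F x \<longleftrightarrow> (\<exists>p\<in>polys_over F. p \<noteq> 0 \<and> poly p x = 0)"

lemma alg_over_base: "subfield F \<Longrightarrow> x \<in> F \<Longrightarrow> alg_over F x"
  unfolding alg_over_def
  by (rule bexI[of _ "[:-x, 1:]"]) (auto simp: polys_over_pCons polys_over_0 intro: subfield_uminus)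

lemma alg_over_inverse:
  assumes F: "subfield F" and x: "alg_over F x" shows "alg_over F (inverse x)"
proof (cases "x = 0")
  case False
  obtain q where q: "q \<in> polys_over F" "q \<noteq> 0" "poly q x = 0" using x by (auto simp: alg_over_def)
  have "poly (reflect_poly q) (inverse x) = 0" using q(3) False by (simp add: poly_reflect_poly_nz)
  moreover have "reflect_poly q \<in> polys_over F" using q(1) F by (auto simp: polys_over_def coeff_reflect_poly)
  ultimately show ?thesis unfolding alg_over_def using q(2) by (intro bexI[of _ "reflect_poly q"]) auto
qed (use x in auto)

lemma alg_over_sum_powers:
  assumes "subfield F" "finite I" "\<And>i. i \<in> I \<Longrightarrow> a i \<in> F" "i \<in> I" "a i \<noteq> 0"
    and "(\<Sum>i\<in>I. a i * x ^ i) = 0"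
  shows "alg_over F x"
proof -
  define p where "p = (\<Sum>i\<in>I. monom (a i) i)"
  have c: "coeff p j = (if j \<in> I then a j else 0)" for j
    using assms(2) by (simp add: p_def coeff_sum)
  have "p \<in> polys_over F" using assms(1,3) by (auto simp: polys_over_def c)
  moreover have "p \<noteq> 0" using c[of i] assms(4,5) by auto
  moreover have "poly p x = 0" using assms(6) by (simp add: p_def poly_sum poly_monom)
  ultimately show ?thesis by (auto simp: alg_over_def)
qed

text \<open>All powers of \<open>x\<close> stay in the span of \<open>B\<close>, so the
  \<open>card B + 1\<close> powers up to exponent \<open>card B\<close> are dependent. Finite
  modules stable under multiplication take the place of degrees of field extensions throughout this
  section.\<close>

lemma alg_over_if_finite_module:
  assumes F: "subfield F" and B: "finite B" and "1 \<in> fspan F B"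
    and x: "\<And>b. b \<in> B \<Longrightarrow> x * b \<in> fspan F B"
  shows "alg_over F x"
proof -
  have pow: "x ^ i \<in> fspan F B" for i
    by (induction i) (auto intro: assms fspan_mult_closed[OF _ F x])
  obtain a where a: "\<forall>i\<in>{..card B}. a i \<in> F" "\<exists>i\<in>{..card B}. a i \<noteq> 0" "(\<Sum>i\<in>{..card B}. a i * x ^ i) = 0"
    using fspan_dependent[OF F B, of "{..card B}" "\<lambda>i. x ^ i"] pow by auto
  then show ?thesis using alg_over_sum_powers[OF F, of "{..card B}" a] by blast
qed

lemma alg_over_power_reduce:
  assumes F: "subfield F" and "alg_over F x"
  shows "\<exists>n f. n > 0 \<and> (\<forall>i<n. f i \<in> F) \<and> x ^ n = (\<Sum>i<n. f i * x ^ i)"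
proof -
  obtain p where p: "p \<in> polys_over F" "p \<noteq> 0" "poly p x = 0"
    using assms(2) by (auto simp: alg_over_def)
  define n where "n = degree p"
  have l: "coeff p n \<noteq> 0" using p by (simp add: n_def)
  have "n > 0"
  proof (rule ccontr)
    assume "\<not> n > 0" then obtain c where "p = [:c:]" using degree_0_id[of p] by (metis n_def gr0I)
    then show False using p by auto
  qed
  have "0 = (\<Sum>i\<le>n. coeff p i * x ^ i)" using p(3) by (simp add: poly_altdef n_def)
  also have "\<dots> = coeff p n * x ^ n + (\<Sum>i<n. coeff p i * x ^ i)"
    by (simp add: lessThan_Suc_atMost[symmetric])
  finally have "coeff p n * x ^ n = - (\<Sum>i<n. coeff p i * x ^ i)" by (simp add: eq_neg_iff_add_eq_0)
  then have "x ^ n = - (\<Sum>i<n. coeff p i * x ^ i) / coeff p n" using l by (simp add: field_simps)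
  also have "\<dots> = (\<Sum>i<n. (- coeff p i / coeff p n) * x ^ i)"
    by (simp add: sum_divide_distrib sum_negf)
  finally have "x ^ n = (\<Sum>i<n. (- coeff p i / coeff p n) * x ^ i)" .
  moreover have "\<forall>i<n. - coeff p i / coeff p n \<in> F"
    using p F by (auto simp: polys_over_def intro!: subfield_closed)
  ultimately show ?thesis using \<open>n > 0\<close>
    by (intro exI[of _ n] exI[of _ "\<lambda>i. - coeff p i / coeff p n"]) auto
qed

text \<open>Multiplication by \<open>x\<close> raises the exponent, and \<open>rel\<close> brings
  x^n back to lower powers. The coefficients \<open>f i\<close> only have to preserve the old
  module; this covers elements of \<open>F\<close> as well as elements that are merely algebraic
  over \<open>F\<close>.\<close>

lemma finite_module_adjoin:
  assumes F: "subfield F" and B: "finite B" "1 \<in> fspan F B"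
    and rel: "x ^ n = (\<Sum>i<n. f i * x ^ i)" and n: "n > 0"
    and f: "\<forall>i<n. \<forall>b\<in>B. f i * b \<in> fspan F B"
  defines "B' \<equiv> (\<lambda>(i, b). x ^ i * b) ` ({..<n} \<times> B)"
  shows "finite B'" "1 \<in> fspan F B'" "\<And>b. b \<in> B' \<Longrightarrow> x * b \<in> fspan F B'"
    and "\<And>y. (\<And>b. b \<in> B \<Longrightarrow> y * b \<in> fspan F B) \<Longrightarrow> (\<And>b. b \<in> B' \<Longrightarrow> y * b \<in> fspan F B')"
proof -
  show fin: "finite B'" using B by (simp add: B'_def)
  have pw: "x ^ i * v \<in> fspan F B'" if "i < n" "v \<in> fspan F B" for i v
    using that(2) F
    by (rule fspan_mult_closed) (rule fspan_base[OF F fin], use that in \<open>auto simp: B'_def\<close>)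
  show "1 \<in> fspan F B'" using pw[OF n B(2)] by simp
  show "y * b \<in> fspan F B'" if y: "\<And>b. b \<in> B \<Longrightarrow> y * b \<in> fspan F B" and b: "b \<in> B'" for y b
  proof -
    obtain i c where "i < n" "c \<in> B" "b = x ^ i * c" using b by (auto simp: B'_def)
    then show ?thesis using pw[of i "y * c"] y[of c] by (simp add: algebra_simps)
  qed
  show "x * b \<in> fspan F B'" if b: "b \<in> B'" for b
  proof -
    obtain i c where i: "i < n" "c \<in> B" "b = x ^ i * c" using b by (auto simp: B'_def)
    show ?thesis
    proof (cases "Suc i < n")
      case True
      then show ?thesis using pw[of "Suc i" c] i fspan_base[OF F B(1)] by (simp add: algebra_simps)
    next
      case False
      then have "Suc i = n" using i by simp
      then have "x * b = x ^ n * c" using i by (auto simp: algebra_simps)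
      also have "\<dots> = (\<Sum>j<n. x ^ j * (f j * c))" by (simp add: rel sum_distrib_left sum_distrib_right algebra_simps)
      also have "\<dots> \<in> fspan F B'" using f i by (intro fspan_sum F pw) auto
      finally show ?thesis .
    qed
  qed
qed

lemma finite_module_algebraic:
  assumes F: "subfield F" and "finite C" "\<forall>c\<in>C. alg_over F c"
  shows "\<exists>B. finite B \<and> 1 \<in> fspan F B \<and> (\<forall>c\<in>C. \<forall>b\<in>B. c * b \<in> fspan F B)"
  using assms(2,3)
proof (induction C rule: finite_induct)
  case empty
  show ?case using F by (intro exI[of _ "{1}"]) (auto intro: fspan_base)
next
  case (insert x C)
  then obtain B where B: "finite B" "1 \<in> fspan F B" "\<forall>c\<in>C. \<forall>b\<in>B. c * b \<in> fspan F B" by blast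
  obtain n f where n: "n > 0" "\<forall>i<n. f i \<in> F" "x ^ n = (\<Sum>i<n. f i * x ^ i)"
    using alg_over_power_reduce[OF F, of x] insert.prems by blast
  have "\<forall>i<n. \<forall>b\<in>B. f i * b \<in> fspan F B"
    using n B F fspan_scale[OF F] fspan_base[OF F B(1)] by blast
  note adj = finite_module_adjoin[OF F B(1,2) n(3,1) this]
  show ?case
  proof (intro exI conjI ballI)
    fix c b assume "c \<in> insert x C" and b: "b \<in> (\<lambda>(i, b). x ^ i * b) ` ({..<n} \<times> B)"
    then consider "c = x" | "c \<in> C" by blast
    then show "c * b \<in> fspan F ((\<lambda>(i, b). x ^ i * b) ` ({..<n} \<times> B))"
      by cases (use adj(3)[OF b] adj(4)[OF _ b] B(3) in blast)+
  qed (use adj(1,2) in blast)+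
qed

lemma alg_over_trans:
  assumes F: "subfield F" and p: "p \<noteq> 0" "poly p x = 0" and c: "\<And>i. alg_over F (coeff p i)"
  shows "alg_over F x"
proof -
  define n where "n = degree p"
  have l: "coeff p n \<noteq> 0" using p by (simp add: n_def)
  have n: "n > 0"
  proof (rule ccontr)
    assume "\<not> n > 0" then obtain c where "p = [:c:]" using degree_0_id[of p] by (metis n_def gr0I)
    then show False using p by auto
  qed
  text \<open>Rescaling by the leading coefficient makes the generator integral over the coefficients.\<close>
  define L where "L = coeff p n"
  define y where "y = L * x"
  obtain B where B: "finite B" "1 \<in> fspan F B" "\<forall>c\<in>coeff p ` {..n}. \<forall>b\<in>B. c * b \<in> fspan F B"
    using finite_module_algebraic[OF F, of "coeff p ` {..n}"] c by auto
  have "0 = (\<Sum>i\<le>n. coeff p i * x ^ i)" using p(2) by (simp add: poly_altdef n_def)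
  also have "\<dots> = L * x ^ n + (\<Sum>i<n. coeff p i * x ^ i)"
    by (simp add: lessThan_Suc_atMost[symmetric] L_def)
  finally have "L * x ^ n = - (\<Sum>i<n. coeff p i * x ^ i)" by (simp add: eq_neg_iff_add_eq_0)
  then have "L ^ (n - 1) * (L * x ^ n) = - (\<Sum>i<n. L ^ (n - 1) * (coeff p i * x ^ i))"
    by (simp add: sum_distrib_left)
  also have "(\<Sum>i<n. L ^ (n - 1) * (coeff p i * x ^ i)) = (\<Sum>i<n. (L ^ (n - 1 - i) * coeff p i) * y ^ i)"
  proof (rule sum.cong)
    fix i assume "i \<in> {..<n}"
    then have "L ^ (n - 1) = L ^ (n - 1 - i) * L ^ i" by (simp add: power_add[symmetric])
    then show "L ^ (n - 1) * (coeff p i * x ^ i) = (L ^ (n - 1 - i) * coeff p i) * y ^ i"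
      by (simp add: y_def power_mult_distrib algebra_simps)
  qed auto
  also have "L ^ (n - 1) * (L * x ^ n) = y ^ n"
    using n by (cases n) (auto simp: y_def power_mult_distrib algebra_simps)
  finally have rel: "y ^ n = (\<Sum>i<n. (- (L ^ (n - 1 - i) * coeff p i)) * y ^ i)" by (simp add: sum_negf)
  have L: "L * v \<in> fspan F B" if "v \<in> fspan F B" for v
    using that F by (rule fspan_mult_closed) (use B(3) in \<open>auto simp: L_def\<close>)
  have Lp: "L ^ m * v \<in> fspan F B" if "v \<in> fspan F B" for m v
    by (induction m) (use L that in \<open>auto simp: mult.assoc\<close>)
  have "\<forall>i<n. \<forall>b\<in>B. (- (L ^ (n - 1 - i) * coeff p i)) * b \<in> fspan F B"
  proof (intro allI ballI impI)
    fix i b assume "i < n" "b \<in> B"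
    then have "L ^ (n - 1 - i) * (coeff p i * b) \<in> fspan F B" using B(3) by (intro Lp) auto
    then have "(- 1) * (L ^ (n - 1 - i) * (coeff p i * b)) \<in> fspan F B"
      by (rule fspan_scale[OF F, rotated]) (use F in \<open>auto intro: subfield_uminus\<close>)
    then show "(- (L ^ (n - 1 - i) * coeff p i)) * b \<in> fspan F B" by (simp add: algebra_simps)
  qed
  note adj = finite_module_adjoin[OF F B(1,2) rel n this]
  let ?B = "(\<lambda>(i, b). y ^ i * b) ` ({..<n} \<times> B)"
  have invL: "alg_over F (inverse L)" using c[of n] by (simp add: L_def alg_over_inverse F)
  have yalg: "alg_over F y" using alg_over_if_finite_module[OF F adj(1,2,3)] .
  have "\<forall>c\<in>{inverse L, y}. alg_over F c" using invL yalg by simp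
  moreover have "finite {inverse L, y}" by simp
  \<comment> \<open>Undoing the rescaling: \<open>x\<close> equals \<open>inverse L * y\<close>, so
    a module stable under both factors is stable under \<open>x\<close>.\<close>
  ultimately obtain C where C: "finite C" "1 \<in> fspan F C" "\<forall>c\<in>{inverse L, y}. \<forall>b\<in>C. c * b \<in> fspan F C"
    using finite_module_algebraic[OF F, of "{inverse L, y}"] by blast
  have "x * b \<in> fspan F C" if "b \<in> C" for b
  proof -
    have "inverse L * (y * b) \<in> fspan F C"
      by (rule fspan_mult_closed[OF _ F]) (use C that in auto)
    moreover have "inverse L * (y * b) = x * b" using l by (simp add: y_def L_def field_simps)
    ultimately show ?thesis by simp
  qed
  then show ?thesis using alg_over_if_finite_module[OF F C(1,2)] by blast
qed

lemma subfield_alg_closure: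
  assumes F: "subfield F" shows "subfield {x. alg_over F x}"
proof -
  have bin: "alg_over F (x + y) \<and> alg_over F (x * y)" if "alg_over F x" "alg_over F y" for x y
  proof -
    have "\<forall>c\<in>{x, y}. alg_over F c" using that by simp
    moreover have "finite {x, y}" by simp
    ultimately obtain C where C: "finite C" "1 \<in> fspan F C" "\<forall>c\<in>{x, y}. \<forall>b\<in>C. c * b \<in> fspan F C"
      using finite_module_algebraic[OF F, of "{x, y}"] by blast
    have "(x + y) * b \<in> fspan F C" if "b \<in> C" for b
      using C that F by (auto simp: distrib_right intro!: fspan_add)
    moreover have "(x * y) * b \<in> fspan F C" if "b \<in> C" for b
      unfolding mult.assoc by (rule fspan_mult_closed[OF _ F]) (use C that in auto)
    ultimately show ?thesis using alg_over_if_finite_module[OF F C(1,2)] by blast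
  qed
  have "alg_over F (- x)" if "alg_over F x" for x
    using bin[OF that alg_over_base[OF F subfield_uminus[OF F subfield_1[OF F]]]] by simp
  then show ?thesis unfolding subfield_def using bin alg_over_inverse F by (auto intro: alg_over_base)
qed


section \<open>Exchange and transcendence bases\<close>

lemma gen_field_insert_fractions:
  assumes y: "y \<in> gen_field k (insert z S)"
  shows "\<exists>P Q. P \<in> polys_over (gen_field k S) \<and> Q \<in> polys_over (gen_field k S)
    \<and> poly Q z \<noteq> 0 \<and> y = poly P z / poly Q z"
proof -
  define F where "F = gen_field k S"
  have F: "subfield F" by (simp add: F_def subfield_gen_field)
  define R where "R = {poly P z / poly Q z |P Q. P \<in> polys_over F \<and> Q \<in> polys_over F \<and> poly Q z \<noteq> 0}"
  have RI: "poly P z / poly Q z \<in> R" if "P \<in> polys_over F" "Q \<in> polys_over F" "poly Q z \<noteq> 0" for P Q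
    using that unfolding R_def by blast
  have const: "c \<in> R" if "c \<in> F" for c
    using RI[of "[:c:]" "[:1:]"] that F by (simp add: polys_over_pCons polys_over_0)
  have "subfield R"
    unfolding subfield_def
  proof (intro conjI ballI)
    show "0 \<in> R" "1 \<in> R" using const F by simp_all
  next
    fix x y assume "x \<in> R" "y \<in> R"
    then obtain P Q P' Q' where P: "P \<in> polys_over F" "Q \<in> polys_over F" "poly Q z \<noteq> 0" "x = poly P z / poly Q z"
      "P' \<in> polys_over F" "Q' \<in> polys_over F" "poly Q' z \<noteq> 0" "y = poly P' z / poly Q' z"
      unfolding R_def by blast
    have "x + y = poly (P * Q' + P' * Q) z / poly (Q * Q') z" "x * y = poly (P * P') z / poly (Q * Q') z"
      using P(3,7) by (simp_all add: P(4,8) field_simps)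
    moreover have "poly (Q * Q') z \<noteq> 0" using P by simp
    ultimately show "x + y \<in> R" "x * y \<in> R"
      using RI[OF polys_over_add[OF F polys_over_mult[OF F P(1,6)] polys_over_mult[OF F P(5,2)]] polys_over_mult[OF F P(2,6)]]
        RI[OF polys_over_mult[OF F P(1,5)] polys_over_mult[OF F P(2,6)]] by simp_all
  next
    fix x assume "x \<in> R"
    then obtain P Q where P: "P \<in> polys_over F" "Q \<in> polys_over F" "poly Q z \<noteq> 0" "x = poly P z / poly Q z"
      unfolding R_def by blast
    show "- x \<in> R" using RI[OF polys_over_uminus[OF F P(1)] P(2,3)] P by simp
    show "inverse x \<in> R"
    proof (cases "poly P z = 0")
      case True
      then show ?thesis using const F P by simp
    next
      case False
      have "inverse x = poly Q z / poly P z" using P by simp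
      then show ?thesis using P False RI by simp
    qed
  qed
  moreover have "k \<subseteq> R" using const gen_field_base F_def by blast
  moreover have "z \<in> R" using RI[of "[:0, 1:]" "[:1:]"] F by (simp add: polys_over_pCons polys_over_0)
  moreover have "S \<subseteq> R" using const gen_field_gen F_def by blast
  ultimately have "gen_field k (insert z S) \<subseteq> R" by (intro gen_field_least) auto
  with y have "y \<in> R" by blast
  then show ?thesis unfolding R_def F_def by blast
qed

definition alg_closure :: "'a::field set \<Rightarrow> 'a set \<Rightarrow> 'a set" where
  "alg_closure k S = {x. alg_over (gen_field k S) x}"

lemma subfield_alg_closure_gen: "subfield (alg_closure k S)"
  unfolding alg_closure_def by (rule subfield_alg_closure[OF subfield_gen_field])

lemma gen_field_subset_alg_closure: "gen_field k S \<subseteq> alg_closure k S"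
  by (auto simp: alg_closure_def intro: alg_over_base subfield_gen_field)

lemma alg_closure_least: "S \<subseteq> alg_closure k T \<Longrightarrow> alg_closure k S \<subseteq> alg_closure k T"
proof
  fix x assume S: "S \<subseteq> alg_closure k T" and x: "x \<in> alg_closure k S"
  have "gen_field k S \<subseteq> alg_closure k T"
    using S gen_field_subset_alg_closure gen_field_base
    by (intro gen_field_least subfield_alg_closure_gen) blast+
  with x obtain p where "p \<noteq> 0" "poly p x = 0" "\<And>i. coeff p i \<in> alg_closure k T"
    by (auto simp: alg_closure_def alg_over_def polys_over_def)
  then show "x \<in> alg_closure k T"
    unfolding alg_closure_def mem_Collect_eq using alg_over_trans[OF subfield_gen_field] by blast
qed

lemma alg_closure_gen: "S \<subseteq> alg_closure k S"
  using gen_field_subset_alg_closure gen_field_gen by blast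

lemma alg_closure_mono: "S \<subseteq> T \<Longrightarrow> alg_closure k S \<subseteq> alg_closure k T"
  by (rule alg_closure_least) (use alg_closure_gen in blast)

text \<open>An algebraic equation for \<open>y\<close> over k(S)(z) is, after clearing denominators,
  a polynomial relation between \<open>y\<close> and \<open>z\<close> over k(S), which can also be
  read as an equation for \<open>z\<close> over k(S)(y). If it were trivial in \<open>z\<close>,
  some power of \<open>z\<close> would carry an algebraic equation for \<open>y\<close> over
  k(S).\<close>

lemma alg_closure_exchange:
  assumes y: "y \<in> alg_closure k (insert z S)" "y \<notin> alg_closure k S"
  shows "z \<in> alg_closure k (insert y S)"
proof -
  define F where "F = gen_field k S"
  have F: "subfield F" by (simp add: F_def subfield_gen_field)
  obtain p where p: "p \<in> polys_over (gen_field k (insert z S))" "p \<noteq> 0" "poly p y = 0"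
    using y(1) by (auto simp: alg_closure_def alg_over_def)
  define n where "n = degree p"
  have "\<forall>i. \<exists>P Q. P \<in> polys_over F \<and> Q \<in> polys_over F \<and> poly Q z \<noteq> 0 \<and> coeff p i = poly P z / poly Q z"
    using p(1) gen_field_insert_fractions[of _ k z S] by (auto simp: polys_over_def F_def)
  then obtain P Q where PQ: "\<And>i. P i \<in> polys_over F" "\<And>i. Q i \<in> polys_over F" "\<And>i. poly (Q i) z \<noteq> 0"
    "\<And>i. coeff p i = poly (P i) z / poly (Q i) z" by metis
  \<comment> \<open>All denominators are multiplied in, except that of \<open>P i\<close> itself, so
    that every coefficient of \<open>p\<close> is scaled by the same nonzero
    \<open>D\<close>.\<close>
  define H where "H i = P i * (\<Prod>j\<in>{..n} - {i}. Q j)" for i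
  define D where "D = (\<Prod>j\<le>n. poly (Q j) z)"
  have "D \<noteq> 0" using PQ(3) by (simp add: D_def)
  have Hz: "poly (H i) z = D * coeff p i" if "i \<le> n" for i
  proof -
    have "D = poly (Q i) z * (\<Prod>j\<in>{..n} - {i}. poly (Q j) z)"
      unfolding D_def using that by (intro prod.remove) auto
    then show ?thesis using PQ(3)[of i] by (simp add: H_def poly_prod PQ(4))
  qed
  have "(\<Prod>j\<in>A. Q j) \<in> polys_over F" for A
    by (induction A rule: infinite_finite_induct)
       (use F PQ(2) in \<open>auto intro!: polys_over_mult simp: one_pCons polys_over_pCons polys_over_0\<close>)
  then have H: "H i \<in> polys_over F" for i unfolding H_def by (intro polys_over_mult F PQ(1))
  define R where "R = (\<Sum>i\<le>n. smult (y ^ i) (H i))"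
  have cR: "coeff R j = (\<Sum>i\<le>n. coeff (H i) j * y ^ i)" for j
    by (simp add: R_def coeff_sum mult.commute)
  have "poly R z = (\<Sum>i\<le>n. y ^ i * (D * coeff p i))" by (simp add: R_def poly_sum Hz)
  also have "\<dots> = D * poly p y" by (simp add: poly_altdef n_def sum_distrib_left algebra_simps)
  finally have "poly R z = 0" using p(3) by simp
  moreover have "R \<noteq> 0"
  proof
    assume "R = 0"
    have "poly (H n) z \<noteq> 0" using Hz[of n] p(2) \<open>D \<noteq> 0\<close> by (simp add: n_def)
    then have "H n \<noteq> 0" by auto
    then obtain j where j: "coeff (H n) j \<noteq> 0" by (auto simp: poly_eq_iff)
    have "(\<Sum>i\<le>n. coeff (H i) j * y ^ i) = 0" using cR[of j] \<open>R = 0\<close> by simp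
    then have "alg_over F y"
      by (intro alg_over_sum_powers[OF F, of "{..n}" "\<lambda>i. coeff (H i) j" n])
         (use H j in \<open>auto simp: polys_over_def\<close>)
    then show False using y(2) by (simp add: alg_closure_def F_def)
  qed
  moreover have "R \<in> polys_over (gen_field k (insert y S))"
    unfolding polys_over_def mem_Collect_eq cR
  proof (intro allI subfield_sum subfield_mult subfield_power subfield_gen_field)
    show "coeff (H i) j \<in> gen_field k (insert y S)" for i j
      using H[of i] gen_field_mono[of S "insert y S" k] by (auto simp: polys_over_def F_def)
  qed (auto intro: gen_field_gen)
  ultimately show ?thesis unfolding alg_closure_def alg_over_def by blast
qed

text \<open>Each entry is transcendental over the later ones. This recursive form of algebraic
  independence suits exchange arguments by induction on the list.\<close>

fun independent_list :: "'a::field set \<Rightarrow> 'a list \<Rightarrow> bool" where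
  "independent_list k [] \<longleftrightarrow> True"
| "independent_list k (x # xs) \<longleftrightarrow> x \<notin> alg_closure k (set xs) \<and> independent_list k xs"

lemma independent_list_replacement:
  assumes "finite T" "independent_list k xs" "set xs \<subseteq> alg_closure k T"
  shows "\<exists>U\<subseteq>T. card U + length xs = card T \<and> T \<subseteq> alg_closure k (set xs \<union> U)"
  using assms(2,3)
proof (induction xs)
  case Nil
  then show ?case using alg_closure_gen by (intro exI[of _ T]) auto
next
  case (Cons x xs)
  then obtain U where U: "U \<subseteq> T" "card U + length xs = card T" "T \<subseteq> alg_closure k (set xs \<union> U)"
    by auto
  have finU: "finite U" using U assms(1) finite_subset by blast
  have hx: "x \<in> alg_closure k (set xs \<union> U)"
    using Cons.prems(2) alg_closure_least[OF U(3)] by auto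
  \<comment> \<open>When the elements of \<open>U\<close> are adjoined one at a time,
    \<open>x\<close> enters the closure at a definite element \<open>z\<close>; this is the one that
    \<open>x\<close> replaces.\<close>
  have "\<exists>z V. V \<subseteq> U \<and> z \<in> U \<and> x \<in> alg_closure k (insert z (set xs \<union> V)) \<and> x \<notin> alg_closure k (set xs \<union> V)"
    if "finite W" "W \<subseteq> U" "x \<in> alg_closure k (set xs \<union> W)" for W
    using that
  proof (induction W rule: finite_induct)
    case empty
    then show ?case using Cons.prems(1) by simp
  next
    case (insert z W)
    then show ?case by (cases "x \<in> alg_closure k (set xs \<union> W)") auto
  qed
  from this[OF finU subset_refl hx] obtain z V where z: "V \<subseteq> U" "z \<in> U" "x \<in> alg_closure k (insert z (set xs \<union> V))"
    "x \<notin> alg_closure k (set xs \<union> V)" by blast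
  have zV: "z \<notin> V" using z(3,4) by (metis UnI2 insert_absorb)
  have "z \<in> alg_closure k (insert x (set xs \<union> V))" using alg_closure_exchange z(3,4) by blast
  also have "\<dots> \<subseteq> alg_closure k (set (x # xs) \<union> (U - {z}))"
    using z zV by (intro alg_closure_mono) auto
  finally have zc: "z \<in> alg_closure k (set (x # xs) \<union> (U - {z}))" .
  have "set xs \<union> U \<subseteq> alg_closure k (set (x # xs) \<union> (U - {z}))"
  proof
    fix y assume "y \<in> set xs \<union> U"
    then show "y \<in> alg_closure k (set (x # xs) \<union> (U - {z}))"
      using zc alg_closure_gen[of "set (x # xs) \<union> (U - {z})" k] by (cases "y = z") auto
  qed
  then have "T \<subseteq> alg_closure k (set (x # xs) \<union> (U - {z}))"
    using alg_closure_least U(3) by blast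
  moreover have "card (U - {z}) + length (x # xs) = card T"
    using U(2) z(2) finU card_Suc_Diff1[OF finU z(2)] by simp
  ultimately show ?case using U(1) by (intro exI[of _ "U - {z}"]) auto
qed

lemma independent_list_length_le:
  assumes "finite T" "independent_list k xs" "set xs \<subseteq> alg_closure k T"
  shows "length xs \<le> card T"
  using independent_list_replacement[OF assms] by auto

text \<open>If an entry of \<open>ts\<close> depended on the later ones, the other entries would
  still span and would be fewer than the independent elements \<open>xs\<close>.\<close>

lemma independent_list_if_spans:
  assumes "independent_list k xs" "set xs \<subseteq> alg_closure k (set ts)" "length ts \<le> length xs"
  shows "independent_list k ts"
proof -
  have "independent_list k us" if "ts = vs @ us" for vs us
    using that
  proof (induction us arbitrary: vs)
    case (Cons u us)
    have "u \<notin> alg_closure k (set us)"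
    proof
      assume u: "u \<in> alg_closure k (set us)"
      have "set ts \<subseteq> alg_closure k (set vs \<union> set us)"
        using u Cons.prems alg_closure_gen[of "set vs \<union> set us" k] alg_closure_mono[of "set us" "set vs \<union> set us" k]
        by auto
      then have "set xs \<subseteq> alg_closure k (set vs \<union> set us)"
        using assms(2) alg_closure_least by blast
      then have "length xs \<le> card (set vs \<union> set us)"
        using assms(1) by (intro independent_list_length_le) auto
      also have "\<dots> \<le> length vs + length us"
        by (metis card_length length_append set_append)
      finally show False using assms(3) Cons.prems by simp
    qed
    moreover have "independent_list k us" using Cons.IH[of "vs @ [u]"] Cons.prems by simp
    ultimately show ?case by simp
  qed simp
  from this[of "[]" ts] show ?thesis by simp
qed

section \<open>Polynomial functions in several variables\<close>

definition mono_val :: "'a::field list \<Rightarrow> nat list \<Rightarrow> 'a" where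
  "mono_val ts e = (\<Prod>i<length ts. (ts ! i) ^ (e ! i))"

lemma mono_val_Cons: "mono_val (x # xs) (n # e) = x ^ n * mono_val xs e"
  unfolding mono_val_def by (simp add: prod.lessThan_Suc_shift del: prod.lessThan_Suc)

lemma mono_val_add:
  assumes "length e = length ts" "length e' = length ts"
  shows "mono_val ts (map2 (+) e e') = mono_val ts e * mono_val ts e'"
  using assms by (simp add: mono_val_def power_add prod.distrib[symmetric])

text \<open>Polynomials are kept as functions on lists, so that the same \<open>f\<close> can be
  evaluated at a generic point and at a special one.\<close>

inductive polyfun :: "'a::field set \<Rightarrow> nat \<Rightarrow> ('a list \<Rightarrow> 'a) \<Rightarrow> bool" for k n where
  polyfun_const: "c \<in> k \<Longrightarrow> polyfun k n (\<lambda>_. c)"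
| polyfun_var: "i < n \<Longrightarrow> polyfun k n (\<lambda>xs. xs ! i)"
| polyfun_add: "polyfun k n f \<Longrightarrow> polyfun k n g \<Longrightarrow> polyfun k n (\<lambda>xs. f xs + g xs)"
| polyfun_mult: "polyfun k n f \<Longrightarrow> polyfun k n g \<Longrightarrow> polyfun k n (\<lambda>xs. f xs * g xs)"

lemma polyfun_normal_form:
  assumes k: "subfield k" and "polyfun k n f"
  shows "\<exists>M c. finite M \<and> (\<forall>e\<in>M. length e = n) \<and> (\<forall>e\<in>M. c e \<in> k) \<and>
    (\<forall>xs. length xs = n \<longrightarrow> f xs = (\<Sum>e\<in>M. c e * mono_val xs e))"
  using assms(2)
proof (induction rule: polyfun.induct)
  case (polyfun_const c)
  then show ?case
    by (intro exI[of _ "{replicate n 0}"] exI[of _ "\<lambda>_. c"]) (auto simp: mono_val_def)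
next
  case (polyfun_var i)
  define e where "e = (replicate n 0)[i := 1::nat]"
  have "mono_val xs e = xs ! i" if "length xs = n" for xs :: "'a list"
  proof -
    have "mono_val xs e = (\<Prod>j<n. if j = i then xs ! i else 1)"
      unfolding mono_val_def that by (intro prod.cong) (auto simp: e_def nth_list_update)
    then show ?thesis using polyfun_var by simp
  qed
  then show ?case using k
    by (intro exI[of _ "{e}"] exI[of _ "\<lambda>_. 1"]) (auto simp: e_def)
next
  case (polyfun_add f g)
  from polyfun_add.IH(1) obtain M c where
    M: "finite M" "\<forall>e\<in>M. length e = n" "\<forall>e\<in>M. c e \<in> k" "\<And>xs. length xs = n \<Longrightarrow> f xs = (\<Sum>e\<in>M. c e * mono_val xs e)"
    by blast
  from polyfun_add.IH(2) obtain N d where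
    N: "finite N" "\<forall>e\<in>N. length e = n" "\<forall>e\<in>N. d e \<in> k" "\<And>xs. length xs = n \<Longrightarrow> g xs = (\<Sum>e\<in>N. d e * mono_val xs e)"
    by blast
  define h where "h = (\<lambda>e. (if e \<in> M then c e else 0) + (if e \<in> N then d e else 0))"
  have "(\<Sum>e\<in>M \<union> N. h e * mono_val xs e) = f xs + g xs" if "length xs = n" for xs
  proof -
    have "(\<Sum>e\<in>M \<union> N. h e * mono_val xs e) =
        (\<Sum>e\<in>M \<union> N. (if e \<in> M then c e * mono_val xs e else 0)) + (\<Sum>e\<in>M \<union> N. (if e \<in> N then d e * mono_val xs e else 0))"
      unfolding sum.distrib[symmetric] by (intro sum.cong) (auto simp: h_def distrib_right)
    also have "\<dots> = (\<Sum>e\<in>M. c e * mono_val xs e) + (\<Sum>e\<in>N. d e * mono_val xs e)"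
      using M(1) N(1) by (intro arg_cong2[of _ _ _ _ "(+)"] sum.mono_neutral_cong_right) auto
    finally show ?thesis using M(4)[OF that] N(4)[OF that] by simp
  qed
  moreover have "\<forall>e\<in>M \<union> N. h e \<in> k" using M(3) N(3) subfield_add[OF k] k by (auto simp: h_def)
  ultimately show ?case using M(1,2) N(1,2) by (intro exI[of _ "M \<union> N"] exI[of _ h]) auto
next
  case (polyfun_mult f g)
  from polyfun_mult.IH(1) obtain M c where
    M: "finite M" "\<forall>e\<in>M. length e = n" "\<forall>e\<in>M. c e \<in> k" "\<And>xs. length xs = n \<Longrightarrow> f xs = (\<Sum>e\<in>M. c e * mono_val xs e)"
    by blast
  from polyfun_mult.IH(2) obtain N d where
    N: "finite N" "\<forall>e\<in>N. length e = n" "\<forall>e\<in>N. d e \<in> k" "\<And>xs. length xs = n \<Longrightarrow> g xs = (\<Sum>e\<in>N. d e * mono_val xs e)"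
    by blast
  define s where "s = (\<lambda>(e, e'). map2 (+) e e' :: nat list)"
  \<comment> \<open>Different pairs of exponents may have the same sum, so the coefficient of a
    monomial of the product collects the whole fibre of exponent addition.\<close>
  define h where "h = (\<lambda>e. \<Sum>(a, b)\<in>{z \<in> M \<times> N. s z = e}. c a * d b)"
  have "(\<Sum>e\<in>s ` (M \<times> N). h e * mono_val xs e) = f xs * g xs" if "length xs = n" for xs
  proof -
    have "f xs * g xs = (\<Sum>(a, b)\<in>M \<times> N. (c a * mono_val xs a) * (d b * mono_val xs b))"
      by (simp add: M(4)[OF that] N(4)[OF that] sum_product sum.cartesian_product)
    also have "\<dots> = (\<Sum>(a, b)\<in>M \<times> N. c a * d b * mono_val xs (s (a, b)))"
      using M(2) N(2) that by (intro sum.cong) (auto simp: s_def mono_val_add)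
    also have "\<dots> = (\<Sum>e\<in>s ` (M \<times> N). \<Sum>z\<in>{z \<in> M \<times> N. s z = e}. (case z of (a, b) \<Rightarrow> c a * d b * mono_val xs (s (a, b))))"
      using M(1) N(1) by (intro sum.image_gen) auto
    also have "\<dots> = (\<Sum>e\<in>s ` (M \<times> N). h e * mono_val xs e)"
      unfolding h_def sum_distrib_right by (intro sum.cong) auto
    finally show ?thesis by simp
  qed
  moreover have "\<forall>e\<in>s ` (M \<times> N). h e \<in> k"
    using M(3) N(3) by (auto simp: h_def intro!: subfield_sum[OF k] subfield_mult[OF k])
  moreover have "\<forall>e\<in>s ` (M \<times> N). length e = n" using M(2) N(2) by (auto simp: s_def)
  ultimately show ?case using M(1) N(1) by (intro exI[of _ "s ` (M \<times> N)"] exI[of _ h]) auto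
qed

lemma alg_indep_iff:
  "alg_indep k ts \<longleftrightarrow> (\<forall>M c. finite M \<and> (\<forall>e\<in>M. length e = length ts) \<and> (\<forall>e\<in>M. c e \<in> k)
     \<and> (\<Sum>e\<in>M. c e * mono_val ts e) = 0 \<longrightarrow> (\<forall>e\<in>M. c e = 0))"
  by (simp add: alg_indep_def mono_val_def)

lemma alg_indepD:
  assumes "alg_indep k ts" "finite M" "\<And>e. e \<in> M \<Longrightarrow> length e = length ts"
    "\<And>e. e \<in> M \<Longrightarrow> c e \<in> k" "(\<Sum>e\<in>M. c e * mono_val ts e) = 0" "e \<in> M"
  shows "c e = 0"
  using assms unfolding alg_indep_iff by blast

text \<open>At an independent point a polynomial vanishes only if all its coefficients do, and then
  it vanishes everywhere. Specialisation rests on this.\<close>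

lemma alg_indep_polyfun_eq_0:
  assumes "subfield k" "alg_indep k xs" "polyfun k (length xs) f" "f xs = 0" "length ys = length xs"
  shows "f ys = 0"
proof -
  obtain M c where M: "finite M" "\<forall>e\<in>M. length e = length xs" "\<forall>e\<in>M. c e \<in> k"
    "\<And>zs. length zs = length xs \<Longrightarrow> f zs = (\<Sum>e\<in>M. c e * mono_val zs e)"
    using polyfun_normal_form[OF assms(1,3)] by auto
  then have "\<forall>e\<in>M. c e = 0" using assms(4) by (auto intro: alg_indepD[OF assms(2) M(1)])
  then show ?thesis using M(4) assms(5) by simp
qed

lemma polyfun_uminus: "subfield k \<Longrightarrow> polyfun k n f \<Longrightarrow> polyfun k n (\<lambda>xs. - f xs)"
  using polyfun_mult[OF polyfun_const[of "- 1" k n], of f] by (simp add: subfield_uminus)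

lemma gen_field_fractions:
  assumes k: "subfield k" and y: "y \<in> gen_field k (set xs)"
  shows "\<exists>f g. polyfun k (length xs) f \<and> polyfun k (length xs) g \<and> g xs \<noteq> 0 \<and> y = f xs / g xs"
proof -
  define n where "n = length xs"
  define R where "R = {f xs / g xs |f g. polyfun k n f \<and> polyfun k n g \<and> g xs \<noteq> 0}"
  have RI: "f xs / g xs \<in> R" if "polyfun k n f" "polyfun k n g" "g xs \<noteq> 0" for f g
    using that unfolding R_def by blast
  have pf: "f xs \<in> R" if "polyfun k n f" for f
    using RI[OF that polyfun_const[of 1]] k by simp
  have const: "c \<in> R" if "c \<in> k" for c using pf[OF polyfun_const[OF that]] .
  have "subfield R"
    unfolding subfield_def
  proof (intro conjI ballI)
    show "0 \<in> R" "1 \<in> R" using const k by simp_all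
  next
    fix x y assume "x \<in> R" "y \<in> R"
    then obtain f g f' g' where P: "polyfun k n f" "polyfun k n g" "g xs \<noteq> 0" "x = f xs / g xs"
      "polyfun k n f'" "polyfun k n g'" "g' xs \<noteq> 0" "y = f' xs / g' xs"
      unfolding R_def by blast
    have "x + y = (f xs * g' xs + f' xs * g xs) / (g xs * g' xs)" "x * y = (f xs * f' xs) / (g xs * g' xs)"
      using P(3,7) by (simp_all add: P(4,8) field_simps)
    then show "x + y \<in> R" "x * y \<in> R"
      using RI[OF polyfun_add[OF polyfun_mult[OF P(1,6)] polyfun_mult[OF P(5,2)]] polyfun_mult[OF P(2,6)]]
        RI[OF polyfun_mult[OF P(1,5)] polyfun_mult[OF P(2,6)]] P by auto
  next
    fix x assume "x \<in> R"
    then obtain f g where P: "polyfun k n f" "polyfun k n g" "g xs \<noteq> 0" "x = f xs / g xs"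
      unfolding R_def by blast
    show "- x \<in> R" using RI[OF polyfun_uminus[OF k P(1)] P(2,3)] P by simp
    show "inverse x \<in> R"
      using RI[OF P(2,1)] P const[of 0] k by (cases "f xs = 0") auto
  qed
  moreover have "k \<subseteq> R" using const by blast
  moreover have "set xs \<subseteq> R" using pf[OF polyfun_var] by (auto simp: in_set_conv_nth n_def)
  ultimately have "gen_field k (set xs) \<subseteq> R" by (intro gen_field_least)
  with y have "y \<in> R" by blast
  then show ?thesis unfolding R_def n_def by blast
qed

lemma mono_val_in_gen_field: "length e = length xs \<Longrightarrow> mono_val xs e \<in> gen_field k (set xs)"
  unfolding mono_val_def
  by (intro subfield_prod subfield_power subfield_gen_field gen_field_gen) auto

text \<open>From left to right, an algebraic equation for \<open>x\<close> is cleared of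
  denominators and expanded into monomials of \<open>x # xs\<close>. From right to left, a relation
  is sorted by the exponent of \<open>x\<close>, the head of the exponent list; transcendence of
  \<open>x\<close> kills each coefficient, and independence of \<open>xs\<close> does the
  rest.\<close>

lemma alg_indep_Cons:
  assumes k: "subfield k"
  shows "alg_indep k (x # xs) \<longleftrightarrow> x \<notin> alg_closure k (set xs) \<and> alg_indep k xs"
proof
  assume ind: "alg_indep k (x # xs)"
  have "alg_indep k xs"
    unfolding alg_indep_iff
  proof (intro allI impI, elim conjE)
    fix M :: "nat list set" and c :: "nat list \<Rightarrow> 'a"
    assume M: "finite M" "\<forall>e\<in>M. length e = length xs" "\<forall>e\<in>M. c e \<in> k" "(\<Sum>e\<in>M. c e * mono_val xs e) = 0"
    have "(\<Sum>e\<in>Cons 0 ` M. c (tl e) * mono_val (x # xs) e) = 0"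
      using M(4) by (subst sum.reindex) (auto simp: mono_val_Cons)
    then have "c (tl e) = 0" if "e \<in> Cons 0 ` M" for e
      by (rule alg_indepD[OF ind, of "Cons 0 ` M" "\<lambda>e. c (tl e)", rotated -2]) (use that M in auto)
    then show "\<forall>e\<in>M. c e = 0" by force
  qed
  moreover have "x \<notin> alg_closure k (set xs)"
  proof
    assume "x \<in> alg_closure k (set xs)"
    then obtain p where p: "p \<in> polys_over (gen_field k (set xs))" "p \<noteq> 0" "poly p x = 0"
      by (auto simp: alg_closure_def alg_over_def)
    define n where "n = degree p"
    have "\<forall>i. \<exists>f g. polyfun k (length xs) f \<and> polyfun k (length xs) g \<and> g xs \<noteq> 0 \<and> coeff p i = f xs / g xs"
      using p(1) gen_field_fractions[OF k] by (auto simp: polys_over_def)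
    then obtain f g where fg: "\<And>i. polyfun k (length xs) (f i)" "\<And>i. polyfun k (length xs) (g i)"
      "\<And>i. g i xs \<noteq> 0" "\<And>i. coeff p i = f i xs / g i xs" by metis
    define h where "h i = (\<lambda>xs. f i xs * (\<Prod>j\<in>{..n} - {i}. g j xs))" for i
    define D where "D = (\<Prod>j\<le>n. g j xs)"
    have "D \<noteq> 0" using fg(3) by (simp add: D_def)
    have hx: "h i xs = D * coeff p i" if "i \<le> n" for i
    proof -
      have "D = g i xs * (\<Prod>j\<in>{..n} - {i}. g j xs)"
        unfolding D_def using that by (intro prod.remove) auto
      then show ?thesis using fg(3)[of i] by (simp add: h_def fg(4))
    qed
    have "polyfun k (length xs) (\<lambda>xs. \<Prod>j\<in>A. g j xs)" for A
      by (induction A rule: infinite_finite_induct)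
         (use k fg(2) in \<open>auto intro: polyfun_mult polyfun_const\<close>)
    then have hpf: "polyfun k (length xs) (h i)" for i unfolding h_def by (intro polyfun_mult fg(1))
    have ex: "\<forall>i. \<exists>Mc. finite (fst Mc) \<and> (\<forall>e\<in>fst Mc. length e = length xs \<and> snd Mc e \<in> k) \<and>
        h i xs = (\<Sum>e\<in>fst Mc. snd Mc e * mono_val xs e)"
    proof
      fix i
      from polyfun_normal_form[OF k hpf[of i]] obtain M c where
        "finite M" "\<forall>e\<in>M. length e = length xs" "\<forall>e\<in>M. c e \<in> k"
        "\<forall>ys. length ys = length xs \<longrightarrow> h i ys = (\<Sum>e\<in>M. c e * mono_val ys e)" by blast
      then show "\<exists>Mc. finite (fst Mc) \<and> (\<forall>e\<in>fst Mc. length e = length xs \<and> snd Mc e \<in> k) \<and>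
        h i xs = (\<Sum>e\<in>fst Mc. snd Mc e * mono_val xs e)" by (intro exI[of _ "(M, c)"]) simp
    qed
    from choice[OF ex] obtain Mc where Mc: "\<forall>i. finite (fst (Mc i)) \<and>
        (\<forall>e\<in>fst (Mc i). length e = length xs \<and> snd (Mc i) e \<in> k) \<and>
        h i xs = (\<Sum>e\<in>fst (Mc i). snd (Mc i) e * mono_val xs e)" by blast
    define M c where "M i = fst (Mc i)" and "c i = snd (Mc i)" for i
    have M: "\<And>i. finite (M i)" "\<And>i e. e \<in> M i \<Longrightarrow> length e = length xs"
      "\<And>i e. e \<in> M i \<Longrightarrow> c i e \<in> k" "\<And>i. h i xs = (\<Sum>e\<in>M i. c i e * mono_val xs e)"
      using Mc unfolding M_def c_def by blast+
    define N where "N = (\<lambda>(i, e). i # e) ` (SIGMA i:{..n}. M i)"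
    have "(\<Sum>e\<in>N. c (hd e) (tl e) * mono_val (x # xs) e)
        = (\<Sum>(i, e)\<in>(SIGMA i:{..n}. M i). c i e * (x ^ i * mono_val xs e))"
      unfolding N_def by (subst sum.reindex) (auto simp: inj_on_def mono_val_Cons intro!: sum.cong)
    also have "\<dots> = (\<Sum>i\<le>n. x ^ i * h i xs)"
      using M(1) by (subst sum.Sigma[symmetric]) (auto simp: M(4) sum_distrib_left algebra_simps)
    also have "\<dots> = D * poly p x" by (simp add: hx poly_altdef n_def sum_distrib_left algebra_simps)
    finally have "(\<Sum>e\<in>N. c (hd e) (tl e) * mono_val (x # xs) e) = 0" using p(3) by simp
    moreover have "finite N" "\<forall>e\<in>N. length e = length (x # xs)" "\<forall>e\<in>N. c (hd e) (tl e) \<in> k"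
      using M by (auto simp: N_def)
    ultimately have z: "\<forall>e\<in>N. c (hd e) (tl e) = 0"
      using alg_indepD[OF ind, of N "\<lambda>e. c (hd e) (tl e)"] by blast
    have "c n e = 0" if "e \<in> M n" for e
      using z[rule_format, of "n # e"] that by (force simp: N_def)
    then have "h n xs = 0" by (simp add: M(4))
    then show False using hx[of n] p(2) \<open>D \<noteq> 0\<close> by (simp add: n_def)
  qed
  ultimately show "x \<notin> alg_closure k (set xs) \<and> alg_indep k xs" by simp
next
  assume as: "x \<notin> alg_closure k (set xs) \<and> alg_indep k xs"
  show "alg_indep k (x # xs)"
    unfolding alg_indep_iff
  proof (intro allI impI, elim conjE)
    fix M :: "nat list set" and c :: "nat list \<Rightarrow> 'a"
    assume M: "finite M" "\<forall>e\<in>M. length e = length (x # xs)" "\<forall>e\<in>M. c e \<in> k" "(\<Sum>e\<in>M. c e * mono_val (x # xs) e) = 0"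
    have Cons: "\<exists>n e'. e = n # e' \<and> length e' = length xs" if "e \<in> M" for e
      using M(2) that by (cases e) auto
    define a where "a n = (\<Sum>e\<in>{e \<in> M. hd e = n}. c e * mono_val xs (tl e))" for n
    have "0 = (\<Sum>n\<in>hd ` M. \<Sum>e\<in>{e \<in> M. hd e = n}. c e * mono_val (x # xs) e)"
      using M(4) sum.image_gen[OF M(1), of "\<lambda>e. c e * mono_val (x # xs) e" hd] by simp
    also have "\<dots> = (\<Sum>n\<in>hd ` M. a n * x ^ n)"
    proof (rule sum.cong)
      fix n
      show "(\<Sum>e\<in>{e \<in> M. hd e = n}. c e * mono_val (x # xs) e) = a n * x ^ n"
        unfolding a_def sum_distrib_right
      proof (rule sum.cong)
        fix e assume "e \<in> {e \<in> M. hd e = n}"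
        then show "c e * mono_val (x # xs) e = c e * mono_val xs (tl e) * x ^ n"
          using Cons[of e] by (auto simp: mono_val_Cons)
      qed simp
    qed simp
    finally have sum0: "(\<Sum>n\<in>hd ` M. a n * x ^ n) = 0" by simp
    have aF: "a n \<in> gen_field k (set xs)" for n
      unfolding a_def
    proof (intro subfield_sum subfield_mult subfield_gen_field)
      fix e assume "e \<in> {e \<in> M. hd e = n}"
      then show "c e \<in> gen_field k (set xs)" "mono_val xs (tl e) \<in> gen_field k (set xs)"
        using M(3) Cons[of e] by (auto intro!: gen_field_base mono_val_in_gen_field)
    qed
    have a0: "a n = 0" if "n \<in> hd ` M" for n
    proof (rule ccontr)
      assume "a n \<noteq> 0"
      then have "alg_over (gen_field k (set xs)) x"
        using alg_over_sum_powers[OF subfield_gen_field, of "hd ` M" a k "set xs" n x] aF sum0 M(1) that by blast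
      then show False using as by (simp add: alg_closure_def)
    qed
    show "\<forall>e\<in>M. c e = 0"
    proof
      fix e assume e: "e \<in> M"
      then obtain n e' where ne: "e = n # e'" using Cons by blast
      define L where "L = tl ` {e \<in> M. hd e = n}"
      have "inj_on tl {e \<in> M. hd e = n}"
      proof (rule inj_onI)
        fix e f assume "e \<in> {e \<in> M. hd e = n}" "f \<in> {e \<in> M. hd e = n}" "tl e = tl f"
        then show "e = f" using Cons[of e] Cons[of f] by auto
      qed
      then have "(\<Sum>e\<in>L. c (n # e) * mono_val xs e) = (\<Sum>e\<in>{e \<in> M. hd e = n}. c (n # tl e) * mono_val xs (tl e))"
        unfolding L_def by (subst sum.reindex) auto
      also have "\<dots> = a n" unfolding a_def
      proof (rule sum.cong)
        fix e assume "e \<in> {e \<in> M. hd e = n}"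
        then show "c (n # tl e) * mono_val xs (tl e) = c e * mono_val xs (tl e)" using Cons[of e] by auto
      qed simp
      finally have "(\<Sum>e\<in>L. c (n # e) * mono_val xs e) = 0" using a0[of n] e ne by force
      moreover have "length e = length xs" "n # e \<in> M" if "e \<in> L" for e
        using that Cons by (fastforce simp: L_def)+
      moreover have "finite L" using M(1) by (simp add: L_def)
      ultimately have "\<forall>e\<in>L. c (n # e) = 0"
        using alg_indepD[OF as[THEN conjunct2], of L "\<lambda>e. c (n # e)"] M(3) by blast
      then show "c e = 0" using e ne by (force simp: L_def)
    qed
  qed
qed

lemma alg_indep_iff_independent_list:
  assumes "subfield k" shows "alg_indep k xs \<longleftrightarrow> independent_list k xs"
proof (induction xs)
  case Nil
  have "\<forall>e\<in>M. c e = 0" if "\<forall>e\<in>M. length e = 0" "(\<Sum>e\<in>M. c e * mono_val [] e) = 0"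
    for M and c :: "nat list \<Rightarrow> 'a"
  proof -
    have "M = {} \<or> M = {[]}" using that(1) by auto
    then show ?thesis using that(2) by (auto simp: mono_val_def)
  qed
  then show ?case by (auto simp: alg_indep_iff)
next
  case (Cons x xs)
  then show ?case using alg_indep_Cons[OF assms] by simp
qed

lemma alg_indep_if_spans:
  assumes "subfield k" "alg_indep k xs" "set xs \<subseteq> alg_closure k (set ts)" "length ts \<le> length xs"
  shows "alg_indep k ts"
  using assms independent_list_if_spans by (simp add: alg_indep_iff_independent_list)


section \<open>Specialisation\<close>

text \<open>The point \<open>xs\<close> is generic, so an identity between rational functions that holds at
  \<open>xs\<close> persists at every point \<open>ys\<close> where the denominators survive. Hence an element is
  nonzero as soon as it specialises to a nonzero value.\<close>

locale specialisation =
  fixes k :: "'a::field set" and xs ys :: "'a list"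
  assumes subfield_k: "subfield k" and indep: "alg_indep k xs" and length_ys: "length ys = length xs"
begin

text \<open>Specialisation is defined only on the local ring of the point \<open>ys\<close>, so it
  is a relation and not a map. The equations are free of division, and \<open>g xs\<close> is
  automatically nonzero because \<open>g ys\<close> is.\<close>

definition spec :: "'a \<Rightarrow> 'a \<Rightarrow> bool" where
  "spec a b \<longleftrightarrow> (\<exists>f g. polyfun k (length xs) f \<and> polyfun k (length xs) g \<and> g ys \<noteq> 0
     \<and> a * g xs = f xs \<and> b * g ys = f ys)"

lemma specI:
  "polyfun k (length xs) f \<Longrightarrow> polyfun k (length xs) g \<Longrightarrow> g ys \<noteq> 0 \<Longrightarrow> a * g xs = f xs \<Longrightarrow> b * g ys = f ys \<Longrightarrow> spec a b"
  unfolding spec_def by blast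

lemma polyfun_specialise_0: "polyfun k (length xs) f \<Longrightarrow> f xs = 0 \<Longrightarrow> f ys = 0"
  using alg_indep_polyfun_eq_0[OF subfield_k indep _ _ length_ys] .

lemma spec_const: "c \<in> k \<Longrightarrow> spec c c"
  using specI[OF polyfun_const[of c k "length xs"] polyfun_const[of 1 k "length xs"]] subfield_k by simp

lemma spec_var: "i < length xs \<Longrightarrow> spec (xs ! i) (ys ! i)"
  using specI[OF polyfun_var polyfun_const[of 1 k "length xs"]] subfield_k by simp

lemma spec_add: assumes "spec a b" "spec a' b'" shows "spec (a + a') (b + b')"
proof -
  obtain f g f' g' where *: "polyfun k (length xs) f" "polyfun k (length xs) g" "g ys \<noteq> 0"
    "a * g xs = f xs" "b * g ys = f ys" "polyfun k (length xs) f'" "polyfun k (length xs) g'" "g' ys \<noteq> 0"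
    "a' * g' xs = f' xs" "b' * g' ys = f' ys" using assms unfolding spec_def by blast
  show ?thesis
    by (rule specI[OF polyfun_add[OF polyfun_mult[OF *(1,7)] polyfun_mult[OF *(6,2)]] polyfun_mult[OF *(2,7)]])
       (use *(3,8) in \<open>auto simp flip: *(4,5,9,10) simp: algebra_simps\<close>)
qed

lemma spec_mult: assumes "spec a b" "spec a' b'" shows "spec (a * a') (b * b')"
proof -
  obtain f g f' g' where *: "polyfun k (length xs) f" "polyfun k (length xs) g" "g ys \<noteq> 0"
    "a * g xs = f xs" "b * g ys = f ys" "polyfun k (length xs) f'" "polyfun k (length xs) g'" "g' ys \<noteq> 0"
    "a' * g' xs = f' xs" "b' * g' ys = f' ys" using assms unfolding spec_def by blast
  show ?thesis
    by (rule specI[OF polyfun_mult[OF *(1,6)] polyfun_mult[OF *(2,7)]])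
       (use *(3,8) in \<open>auto simp flip: *(4,5,9,10) simp: algebra_simps\<close>)
qed

lemma spec_uminus: "spec a b \<Longrightarrow> spec (- a) (- b)"
  using spec_mult[OF spec_const[of "- 1"], of a b] subfield_k by (simp add: subfield_uminus)

lemma spec_diff: "spec a b \<Longrightarrow> spec a' b' \<Longrightarrow> spec (a - a') (b - b')"
  using spec_add[OF _ spec_uminus, of a b a' b'] by simp

lemma spec_nonzero: assumes "spec a b" "b \<noteq> 0" shows "a \<noteq> 0"
proof
  assume "a = 0"
  obtain f g where *: "polyfun k (length xs) f" "g ys \<noteq> 0" "a * g xs = f xs" "b * g ys = f ys"
    using assms unfolding spec_def by blast
  then have "f ys = 0" using polyfun_specialise_0[OF *(1)] \<open>a = 0\<close> by simp
  then show False using * assms(2) by simp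
qed

lemma spec_inverse: assumes "spec a b" "b \<noteq> 0" shows "spec (inverse a) (inverse b)"
proof -
  have "a \<noteq> 0" using spec_nonzero assms by blast
  obtain f g where *: "polyfun k (length xs) f" "polyfun k (length xs) g" "g ys \<noteq> 0"
    "a * g xs = f xs" "b * g ys = f ys" using assms unfolding spec_def by blast
  have fy: "f ys \<noteq> 0" using *(3) assms(2) by (simp flip: *(5))
  show ?thesis
    by (rule specI[OF *(2,1) fy]) (use \<open>a \<noteq> 0\<close> assms(2) in \<open>simp_all flip: *(4,5)\<close>)
qed

lemma spec_divide: "spec a b \<Longrightarrow> spec a' b' \<Longrightarrow> b' \<noteq> 0 \<Longrightarrow> spec (a / a') (b / b')"
  using spec_mult[OF _ spec_inverse] by (simp add: divide_inverse)

lemma spec_power: "spec a b \<Longrightarrow> spec (a ^ n) (b ^ n)"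
  by (induction n) (auto intro: spec_mult spec_const simp: subfield_k)

lemma spec_numeral: "spec (numeral n) (numeral n)"
  by (intro spec_const subfield_numeral subfield_k)

lemmas spec_intros = spec_add spec_mult spec_diff spec_uminus spec_divide spec_power spec_numeral

end

section \<open>Automorphisms and fixed fields\<close>

lemma
  assumes "k_aut k h"
  shows k_aut_add: "h (x + y) = h x + h y" and k_aut_mult: "h (x * y) = h x * h y"
    and k_aut_const: "c \<in> k \<Longrightarrow> h c = c" and k_aut_0: "h 0 = 0" and k_aut_1: "h 1 = 1"
    and k_aut_uminus: "h (- x) = - h x" and k_aut_diff: "h (x - y) = h x - h y"
    and k_aut_inverse: "h (inverse x) = inverse (h x)" and k_aut_divide: "h (x / y) = h x / h y"
    and k_aut_power: "h (x ^ n) = h x ^ n" and k_aut_numeral: "h (numeral m) = numeral m"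
proof -
  show add: "h (x + y) = h x + h y" and mult: "h (x * y) = h x * h y" for x y
    using assms by (auto simp: k_aut_def)
  show "c \<in> k \<Longrightarrow> h c = c" using assms by (auto simp: k_aut_def)
  have "h 0 + h 0 = h 0 + 0" using add[of 0 0] by (metis add_0 add_0_right)
  then show zero: "h 0 = 0" by (simp only: add_left_cancel)
  have "inj h" using assms by (simp add: k_aut_def bij_def)
  then have inj: "h x = h y \<Longrightarrow> x = y" for x y by (simp add: inj_eq)
  have "h 1 * h 1 = h 1" "h 1 \<noteq> 0" using mult[of 1 1] inj[of 1 0] zero by auto
  then show one: "h 1 = 1" by simp
  show um: "h (- x) = - h x" for x using add[of x "- x"] zero by (simp add: eq_neg_iff_add_eq_0 add.commute)
  show "h (x - y) = h x - h y" using add[of x "- y"] um by simp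
  show inv: "h (inverse x) = inverse (h x)" for x
  proof (cases "x = 0")
    case False
    then have "h x * h (inverse x) = 1" using mult[of x "inverse x"] one by simp
    then show ?thesis by (simp add: inverse_unique)
  qed (simp add: zero)
  show "h (x / y) = h x / h y" using mult[of x "inverse y"] inv by (simp add: divide_inverse)
  show pow: "h (x ^ n) = h x ^ n" for n by (induction n) (auto simp: one mult)
  have "h (of_nat n) = of_nat n" for n by (induction n) (auto simp: zero one add)
  from this[of "numeral m"] show "h (numeral m) = numeral m" by simp
qed

lemmas k_aut_simps = k_aut_add k_aut_mult k_aut_const k_aut_0 k_aut_1 k_aut_uminus k_aut_diff
  k_aut_inverse k_aut_divide k_aut_power k_aut_numeral

lemma subfield_fixed: assumes "k_aut k h" shows "subfield {y. h y = y}"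
  using assms by (auto simp: subfield_def k_aut_simps[OF assms])

lemma k_aut_fixes_gen_field:
  assumes "k_aut k h" "\<And>t. t \<in> T \<Longrightarrow> h t = t" "y \<in> gen_field k T" shows "h y = y"
proof -
  have "gen_field k T \<subseteq> {y. h y = y}"
    using assms(1,2) by (intro gen_field_least subfield_fixed) (auto simp: k_aut_const)
  then show ?thesis using assms(3) by blast
qed

lemma k_aut_comp: "k_aut k g \<Longrightarrow> k_aut k h \<Longrightarrow> k_aut k (g \<circ> h)"
  by (auto simp: k_aut_def intro: bij_comp)

lemma k_aut_poly: assumes "k_aut k h" "\<And>i. h (coeff p i) = coeff p i" shows "h (poly p x) = poly p (h x)"
proof -
  have "h (\<Sum>i\<in>A. f i) = (\<Sum>i\<in>A. h (f i))" for A :: "nat set" and f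
    by (induction A rule: infinite_finite_induct) (auto simp: k_aut_simps[OF assms(1)])
  then show ?thesis using assms by (simp add: poly_altdef k_aut_simps[OF assms(1)])
qed

section \<open>Fixed elements of cubic, quadratic and biquadratic extensions\<close>

lemma gen_field_single_fractions:
  assumes "subfield F" "y \<in> gen_field F {t}"
  shows "\<exists>P Q. P \<in> polys_over F \<and> Q \<in> polys_over F \<and> poly Q t \<noteq> 0 \<and> y = poly P t / poly Q t"
  using gen_field_insert_fractions[of y F t "{}"] assms by (simp add: gen_field_empty)

text \<open>Division with remainder by the cubic, expressed through values at its roots: one
  remainder serves all conjugates at once.\<close>

lemma cubic_reduce:
  assumes F: "subfield F" "e1 \<in> F" "e2 \<in> F" "e3 \<in> F" and P: "P \<in> polys_over F"
  shows "\<exists>R\<in>polys_over F. degree R \<le> 2 \<and> (\<forall>t. t ^ 3 = e1 * t ^ 2 - e2 * t + e3 \<longrightarrow> poly P t = poly R t)"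
  using P
proof (induction P)
  case 0
  then show ?case by (intro bexI[of _ 0]) auto
next
  case (pCons d P)
  then obtain R where R: "R \<in> polys_over F" "degree R \<le> 2"
    "\<forall>t. t ^ 3 = e1 * t ^ 2 - e2 * t + e3 \<longrightarrow> poly P t = poly R t"
    by (auto simp: polys_over_pCons)
  define a b c where abc: "a = coeff R 0" "b = coeff R 1" "c = coeff R 2"
  have Rt: "poly R t = a + b * t + c * t ^ 2" for t
  proof -
    have "R = [:a, b, c:]"
      using R(2) by (intro poly_eqI) (auto simp: abc coeff_pCons coeff_eq_0 numeral_2_eq_2 split: nat.splits)
    then show ?thesis by (simp add: algebra_simps power2_eq_square)
  qed
  \<comment> \<open>The result of substituting the cubic relation for t^3 in d + a t + b t^2 + c
    t^3.\<close>
  define R' where "R' = [:d + c * e3, a - c * e2, b + c * e1:]"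
  have "poly (pCons d P) t = poly R' t" if t: "t ^ 3 = e1 * t ^ 2 - e2 * t + e3" for t
  proof -
    have "poly (pCons d P) t = d + a * t + b * t ^ 2 + c * t ^ 3"
      using R(3) t by (simp add: Rt algebra_simps power2_eq_square power3_eq_cube)
    then show ?thesis unfolding t by (simp add: R'_def algebra_simps power2_eq_square)
  qed
  moreover have "R' \<in> polys_over F"
    using pCons.prems R(1) F
    by (auto simp: R'_def polys_over_pCons polys_over_0 abc polys_over_def[of F, THEN eq_reflection, symmetric]
        intro!: subfield_closed) (auto simp: polys_over_def)
  moreover have "degree R' \<le> 2" by (simp add: R'_def)
  ultimately show ?case by blast
qed

text \<open>With numerator R and denominator S reduced to degree at most 2, a fixed \<open>y\<close>
  makes y S - R vanish at three distinct conjugates. So this polynomial is zero, and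
  \<open>y\<close> is a quotient of coefficients.\<close>

lemma fixed_in_cubic_extension:
  assumes F: "subfield F" "e1 \<in> F" "e2 \<in> F" "e3 \<in> F"
    and h: "k_aut k h" "\<And>y. y \<in> F \<Longrightarrow> h y = y"
    and roots: "\<And>t. t \<in> {x, h x, h (h x)} \<Longrightarrow> t ^ 3 = e1 * t ^ 2 - e2 * t + e3"
    and distinct: "card {x, h x, h (h x)} = 3"
    and y: "y \<in> gen_field F {x}" "h y = y"
  shows "y \<in> F"
proof -
  obtain P Q where PQ: "P \<in> polys_over F" "Q \<in> polys_over F" "poly Q x \<noteq> 0" "y = poly P x / poly Q x"
    using gen_field_single_fractions F(1) y(1) by blast
  obtain R where R: "R \<in> polys_over F" "degree R \<le> 2"
    "\<forall>t. t ^ 3 = e1 * t ^ 2 - e2 * t + e3 \<longrightarrow> poly P t = poly R t"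
    using cubic_reduce[OF F PQ(1)] by blast
  obtain S where S: "S \<in> polys_over F" "degree S \<le> 2"
    "\<forall>t. t ^ 3 = e1 * t ^ 2 - e2 * t + e3 \<longrightarrow> poly Q t = poly S t"
    using cubic_reduce[OF F PQ(2)] by blast
  have hp: "h (poly T t) = poly T (h t)" if "T \<in> polys_over F" for T t
    using that h(2) by (intro k_aut_poly[OF h(1)]) (auto simp: polys_over_def)
  have "y * poly Q x = poly P x" using PQ by simp
  then have e0: "y * poly S x = poly R x" using R(3) S(3) roots by simp
  from arg_cong[OF e0, of h] have e1: "y * poly S (h x) = poly R (h x)"
    using y(2) by (simp add: k_aut_mult[OF h(1)] hp R S)
  from arg_cong[OF e1, of h] have e2: "y * poly S (h (h x)) = poly R (h (h x))"
    using y(2) by (simp add: k_aut_mult[OF h(1)] hp R S)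
  define T where "T = smult y S - R"
  have "T = 0"
  proof (rule ccontr)
    assume "T \<noteq> 0"
    have "{x, h x, h (h x)} \<subseteq> {t. poly T t = 0}" using e0 e1 e2 by (auto simp: T_def)
    then have "3 \<le> card {t. poly T t = 0}"
      using distinct card_mono[OF poly_roots_finite[OF \<open>T \<noteq> 0\<close>]] by metis
    also have "\<dots> \<le> degree T" using \<open>T \<noteq> 0\<close> by (rule card_poly_roots_bound)
    also have "\<dots> \<le> 2" unfolding T_def by (rule degree_diff_le) (use R S degree_smult_le[of y S] in auto)
    finally show False by simp
  qed
  have "S \<noteq> 0" using PQ(3) S(3) roots by auto
  then obtain i where i: "coeff S i \<noteq> 0" by (auto simp: poly_eq_iff)
  have "y * coeff S i - coeff R i = coeff T i" by (simp add: T_def)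
  then have "y = coeff R i / coeff S i" using i \<open>T = 0\<close> by (simp add: field_simps)
  then show ?thesis using R(1) S(1) F(1) by (auto simp: polys_over_def intro: subfield_divide)
qed

lemma quadratic_reduce:
  assumes F: "subfield F" "e \<in> F" and P: "P \<in> polys_over F"
  shows "\<exists>a\<in>F. \<exists>b\<in>F. \<forall>t. t ^ 2 = e \<longrightarrow> poly P t = a + b * t"
  using P
proof (induction P)
  case 0
  then show ?case using F(1) by (intro bexI[of _ 0]) auto
next
  case (pCons d P)
  then obtain a b where ab: "a \<in> F" "b \<in> F" "\<forall>t. t ^ 2 = e \<longrightarrow> poly P t = a + b * t" "d \<in> F"
    by (auto simp: polys_over_pCons)
  have "poly (pCons d P) t = (d + b * e) + a * t" if "t ^ 2 = e" for t
    using ab(3) that by (auto simp: algebra_simps power2_eq_square)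
  moreover have "d + b * e \<in> F" using ab F by (intro subfield_closed)
  ultimately show ?case using ab(1) by blast
qed

lemma fixed_in_quadratic_extension:
  assumes F: "subfield F" "t ^ 2 \<in> F"
    and h: "k_aut k h" "\<And>y. y \<in> F \<Longrightarrow> h y = y" "h t = - t" and t: "t \<noteq> 0" and two: "(2::'a::field) \<noteq> 0"
    and y: "y \<in> gen_field F {t :: 'a}" "h y = y"
  shows "y \<in> F"
proof -
  obtain P Q where PQ: "P \<in> polys_over F" "Q \<in> polys_over F" "poly Q t \<noteq> 0" "y = poly P t / poly Q t"
    using gen_field_single_fractions F(1) y(1) by blast
  obtain a b c d where ab: "a \<in> F" "b \<in> F" "poly P t = a + b * t" "c \<in> F" "d \<in> F" "poly Q t = c + d * t"
    using quadratic_reduce[OF F PQ(1)] quadratic_reduce[OF F PQ(2)] by blast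
  have e: "y * (c + d * t) = a + b * t" using PQ ab by simp
  from arg_cong[OF e, of h] have "y * (c - d * t) = a - b * t"
    using ab h y(2) by (simp add: k_aut_simps[OF h(1)])
  with e have "2 * (y * c - a) = 0" "2 * t * (y * d - b) = 0" by algebra+
  then have "y * c = a" "y * d = b" using two t by auto
  moreover have "c \<noteq> 0 \<or> d \<noteq> 0" using PQ ab by auto
  ultimately have "y = a / c \<and> c \<noteq> 0 \<or> y = b / d \<and> d \<noteq> 0" by auto
  then show ?thesis using ab F(1) by (auto intro: subfield_divide)
qed

text \<open>Descent in two quadratic steps: \<open>g\<close> fixes F(t1) and moves
  \<open>t2\<close>, which forces \<open>y\<close> into F(t1); then \<open>h\<close>, which moves
  \<open>t1\<close>, forces \<open>y\<close> into F.\<close>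

lemma fixed_in_biquadratic_extension:
  fixes t1 t2 :: "'a::field"
  assumes F: "subfield F" "t1 ^ 2 \<in> F" "t2 ^ 2 \<in> F" "gen_field F {t1, t2} = UNIV"
    and g: "k_aut k g" "\<And>y. y \<in> F \<Longrightarrow> g y = y" "g t1 = t1" "g t2 = - t2"
    and h: "k_aut k h" "\<And>y. y \<in> F \<Longrightarrow> h y = y" "h t1 = - t1"
    and nz: "t1 \<noteq> 0" "t2 \<noteq> 0" "(2::'a) \<noteq> 0"
  shows "{y. g y = y \<and> h y = y} = F"
proof
  show "{y. g y = y \<and> h y = y} \<subseteq> F"
  proof
    fix y assume "y \<in> {y. g y = y \<and> h y = y}"
    then have y: "g y = y" "h y = y" by auto
    have gfix: "g z = z" if "z \<in> gen_field F {t1}" for z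
    proof -
      have "gen_field F {t1} \<subseteq> {y. g y = y}"
        using g by (intro gen_field_least subfield_fixed[OF g(1)]) auto
      then show ?thesis using that by blast
    qed
    have "gen_field (gen_field F {t1}) {t2} = UNIV" using F(4) by (simp add: gen_field_gen_field insert_commute)
    then have yF: "y \<in> gen_field F {t1}"
      by (intro fixed_in_quadratic_extension[OF subfield_gen_field gen_field_base[OF F(3)] g(1) gfix g(4) nz(2,3) _ y(1)]) auto
    show "y \<in> F"
      using fixed_in_quadratic_extension[OF F(1,2) h nz(1,3) yF y(2)] .
  qed
qed (use g(2) h(2) in auto)


section \<open>Cyclic permutations of three variables\<close>

lemma sqrt_in_alg_closure: assumes "t ^ 2 \<in> gen_field k S" shows "t \<in> alg_closure k S"
  unfolding alg_closure_def alg_over_def mem_Collect_eq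
  using assms by (intro bexI[of _ "[:- (t ^ 2), 0, 1:]"])
    (auto simp: power2_eq_square polys_over_pCons polys_over_0 subfield_gen_field intro: subfield_closed)

lemma cubic_root_in_alg_closure:
  assumes "e1 \<in> gen_field k S" "e2 \<in> gen_field k S" "e3 \<in> gen_field k S" "t ^ 3 = e1 * t ^ 2 - e2 * t + e3"
  shows "t \<in> alg_closure k S"
  unfolding alg_closure_def alg_over_def mem_Collect_eq
  using assms by (intro bexI[of _ "[:- e3, e2, - e1, 1:]"])
    (auto simp: power2_eq_square power3_eq_cube algebra_simps polys_over_pCons polys_over_0 subfield_gen_field intro: subfield_closed)

lemma alg_indep_poly_nonzero:
  assumes "subfield k" "alg_indep k (x # xs)" "p \<in> polys_over (gen_field k (set xs))" "p \<noteq> 0"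
  shows "poly p x \<noteq> 0"
  using assms by (auto simp: alg_indep_Cons alg_closure_def alg_over_def)

text \<open>The generators \<open>U\<close>, \<open>V\<close> below are Masuda's; they work in every characteristic.\<close>

theorem cyclic_fixed_field_rational:
  fixes x y z :: "'a::field"
  assumes k: "subfield k" and ind: "alg_indep k [x, y, z]"
    and s: "k_aut k s" "s x = y" "s y = z" "s z = x"
  shows "k_rational k (gen_field k {x, y, z} \<inter> {w. s w = w})"
proof -
  define N where "N = x^2 + y^2 + z^2 - x*y - y*z - z*x"
  define U where "U = (x*y^2 + y*z^2 + z*x^2 - 3*x*y*z) / N"
  define V where "V = (x^2*y + y^2*z + z^2*x - 3*x*y*z) / N"
  define S where "S = x + y + z"
  define E where "E = gen_field k {S, U, V}"
  have E: "subfield E" by (simp add: E_def subfield_gen_field)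
  have SUV: "S \<in> E" "U \<in> E" "V \<in> E" by (auto simp: E_def intro: gen_field_gen)
  have yz: "y \<in> gen_field k (set [y, z])" "z \<in> gen_field k (set [y, z])" by (auto intro: gen_field_gen)
  note cl = polys_over_pCons polys_over_0 subfield_gen_field
  have "poly [:y^2 + z^2 - y*z, - (y + z), 1:] x \<noteq> 0"
    by (rule alg_indep_poly_nonzero[OF k ind])
       (use yz in \<open>auto simp: cl intro!: subfield_closed[OF subfield_gen_field]\<close>)
  then have N: "N \<noteq> 0" by (simp add: N_def algebra_simps power2_eq_square)
  have "x \<noteq> t" if "t \<in> gen_field k (set [y, z])" for t
    using alg_indep_poly_nonzero[OF k ind, of "[:- t, 1:]"] that
    by (auto simp: cl subfield_uminus[OF subfield_gen_field])
  then have xy: "x \<noteq> y" "x \<noteq> z" using yz by auto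
  have yz': "y \<noteq> z" using xy(1) s by metis
  have sN: "s N = N" "s S = S" by (simp_all add: N_def S_def k_aut_simps[OF s(1)] s algebra_simps)
  have sUV: "s U = U" "s V = V"
    unfolding U_def V_def by (simp_all add: k_aut_simps[OF s(1)] s sN algebra_simps)
  have sE: "s w = w" if "w \<in> E" for w
    using k_aut_fixes_gen_field[OF s(1), of "{S, U, V}"] that sN sUV by (auto simp: E_def)
  have NU: "N * U = x*y^2 + y*z^2 + z*x^2 - 3*x*y*z" "N * V = x^2*y + y^2*z + z^2*x - 3*x*y*z"
    using N by (simp_all add: U_def V_def)
  \<comment> \<open>\<open>N\<close> and the differences of x, y, z with \<open>U\<close> and
    \<open>V\<close> are invariant under translation, so they factor in terms of \<open>d\<close>,
    \<open>f\<close> and z - y = d + f.\<close>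
  define d where "d = x - y"
  define f where "f = z - x"
  have df: "d \<noteq> 0" "f \<noteq> 0" "d + f \<noteq> 0" using xy yz' by (auto simp: d_def f_def)
  have xU: "N * (x - U) = d * f^2" "N * (x - V) = - f * d^2"
    and yU: "N * (y - U) = - (d + f) * d^2" "N * (y - V) = - d * (d + f)^2"
    and zU: "N * (z - U) = f * (d + f)^2" "N * (z - V) = (d + f) * f^2"
    using NU unfolding N_def d_def f_def by algebra+
  have UV: "N * (U - V) = - d * f * (d + f)" using xU by algebra
  have Ndf: "N = d^2 + d*f + f^2" unfolding N_def d_def f_def by algebra
  have UV0: "U \<noteq> V" using UV df by auto
  \<comment> \<open>These are the elementary symmetric functions of x, y, z. The cubic with these
    roots takes the values -(U - V)^3 at \<open>U\<close> and (U - V)^3 at \<open>V\<close>; the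
    difference of the two values, divided by U - V, determines \<open>e2\<close>, and the value at
    \<open>U\<close> then determines \<open>e3\<close>.\<close>
  define e2 where "e2 = S * (U + V) - (U^2 + U*V + V^2) - 2 * (U - V)^2"
  define e3 where "e3 = U^3 - S * U^2 + e2 * U + (U - V)^3"
  have e23: "e2 \<in> E" "e3 \<in> E" unfolding e2_def e3_def using SUV E by (auto intro!: subfield_closed)
  have "N^3 * ((x - U) * (y - U) * (z - U)) = N^3 * (U - V)^3"
  proof -
    have "N^3 * ((x - U) * (y - U) * (z - U)) = (N * (x - U)) * (N * (y - U)) * (N * (z - U))" by algebra
    also have "\<dots> = (N * (U - V))^3" unfolding xU yU zU UV by algebra
    finally show ?thesis by algebra
  qed
  then have prodU: "(x - U) * (y - U) * (z - U) = (U - V)^3" using N by simp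
  have "N^3 * ((x - V) * (y - V) * (z - V)) = - (N^3 * (U - V)^3)"
  proof -
    have "N^3 * ((x - V) * (y - V) * (z - V)) = (N * (x - V)) * (N * (y - V)) * (N * (z - V))" by algebra
    also have "\<dots> = - ((N * (U - V))^3)" unfolding xU yU zU UV by algebra
    finally show ?thesis by algebra
  qed
  then have "N^3 * ((x - V) * (y - V) * (z - V) + (U - V)^3) = 0" by (simp add: distrib_left)
  then have prodV: "(x - V) * (y - V) * (z - V) = - ((U - V)^3)" using N by (simp add: eq_neg_iff_add_eq_0)
  have "(U - V) * (x*y + y*z + z*x - e2) = 0"
    using prodU prodV unfolding e2_def S_def by algebra
  then have e2: "e2 = x*y + y*z + z*x" using UV0 by simp
  have e3: "e3 = x*y*z" using prodU unfolding e3_def e2 S_def by algebra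
  have roots: "t ^ 3 = S * t ^ 2 - e2 * t + e3" if "t \<in> {x, y, z}" for t
  proof -
    have "(t - x) * (t - y) * (t - z) = 0" using that by auto
    then show ?thesis unfolding S_def e2 e3 by algebra
  qed
  have yzE: "y \<in> gen_field E {x}" "z \<in> gen_field E {x}"
  proof -
    let ?L = "gen_field E {x}"
    have L: "x \<in> ?L" "U \<in> ?L" "V \<in> ?L" "S \<in> ?L"
      using SUV by (auto intro: gen_field_gen gen_field_base)
    have xV0: "x - V \<noteq> 0" using xU(2) df by auto
    \<comment> \<open>By the factorisations of x - U and x - V this is the ratio f/d. Since U - V is
      homogeneous of degree 1 in \<open>d\<close> and \<open>f\<close>, knowing the ratio and U - V
      gives \<open>d\<close> itself.\<close>
    define \<rho> where "\<rho> = - (x - U) / (x - V)"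
    have "\<rho> \<in> ?L" unfolding \<rho>_def using L by (intro subfield_closed[OF subfield_gen_field])
    have "(N * (x - V)) * f = - (N * (x - U)) * d" unfolding xU by algebra
    then have "N * ((x - V) * f) = N * (- (x - U) * d)" by algebra
    then have "(x - V) * f = - (x - U) * d" using N by simp
    then have f: "f = \<rho> * d" using xV0 by (simp add: \<rho>_def field_simps)
    have "d + f = (1 + \<rho>) * d" unfolding f by algebra
    then have \<rho>0: "\<rho> \<noteq> 0" "1 + \<rho> \<noteq> 0" using df f by auto
    have "d^2 * ((1 + \<rho> + \<rho>^2) * (U - V) + d * (\<rho> * (1 + \<rho>))) = 0"
      using UV unfolding Ndf f by algebra
    then have "(1 + \<rho> + \<rho>^2) * (U - V) + d * (\<rho> * (1 + \<rho>)) = 0" using df(1) by simp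
    then have "d * (\<rho> * (1 + \<rho>)) = - (1 + \<rho> + \<rho>^2) * (U - V)" by algebra
    then have "d = - (1 + \<rho> + \<rho>^2) * (U - V) / (\<rho> * (1 + \<rho>))"
      using \<rho>0 by (subst nonzero_eq_divide_eq) simp_all
    moreover have "\<dots> \<in> ?L" using L \<open>\<rho> \<in> ?L\<close> by (intro subfield_closed[OF subfield_gen_field])
    ultimately have "d \<in> ?L" by simp
    then have "x - d \<in> ?L" "S - x - (x - d) \<in> ?L" using L by (intro subfield_closed[OF subfield_gen_field]; simp)+
    then show "y \<in> ?L" "z \<in> ?L" by (simp_all add: d_def S_def)
  qed
  have "gen_field k {x, y, z} \<inter> {w. s w = w} = E"
  proof
    show "E \<subseteq> gen_field k {x, y, z} \<inter> {w. s w = w}"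
    proof
      fix w assume w: "w \<in> E"
      have "x \<in> gen_field k {x, y, z}" "y \<in> gen_field k {x, y, z}" "z \<in> gen_field k {x, y, z}"
        by (auto intro: gen_field_gen)
      then have "{S, U, V} \<subseteq> gen_field k {x, y, z}"
        unfolding S_def U_def V_def N_def by (auto intro!: subfield_closed[OF subfield_gen_field])
      then have "E \<subseteq> gen_field k {x, y, z}" unfolding E_def
        by (intro gen_field_least subfield_gen_field) (auto intro: gen_field_base)
      then show "w \<in> gen_field k {x, y, z} \<inter> {w. s w = w}" using w sE by blast
    qed
    show "gen_field k {x, y, z} \<inter> {w. s w = w} \<subseteq> E"
    proof
      fix w assume w: "w \<in> gen_field k {x, y, z} \<inter> {w. s w = w}"
      have "gen_field k {x, y, z} \<subseteq> gen_field E {x}"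
        using yzE by (intro gen_field_least subfield_gen_field)
          (auto intro: gen_field_gen gen_field_base simp: E_def)
      then show "w \<in> E"
        using w s xy yz' roots
        by (intro fixed_in_cubic_extension[OF E SUV(1) e23 s(1) sE, of x w]) auto
    qed
  qed
  moreover have "alg_indep k [S, U, V]"
  proof (rule alg_indep_if_spans[OF k ind])
    show "set [x, y, z] \<subseteq> alg_closure k (set [S, U, V])"
      using roots SUV e23 by (auto simp: E_def intro: cubic_root_in_alg_closure)
  qed simp
  ultimately show ?thesis
    unfolding k_rational_def using SUV by (intro exI[of _ "[S, U, V]"]) (auto simp: E_def)
qed

text \<open>The common last step for both signs. Independence of the \<open>b\<close>'s follows by
  counting: adjoining two square roots to F gives the whole field, so the three independent elements
  are algebraic over k(b1, b2, b3).\<close>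

lemma rational_if_biquadratic_over_cyclic:
  fixes k :: "'a::field set" and b1 b2 b3 t1 t2 :: 'a
  defines "F \<equiv> gen_field k {b1, b2, b3}"
  assumes k: "subfield k" and ind: "alg_indep k [x1, x2, x3]"
    and F: "t1 ^ 2 \<in> F" "t2 ^ 2 \<in> F" "gen_field F {t1, t2} = UNIV"
    and g: "k_aut k g" "g b1 = b1" "g b2 = b2" "g b3 = b3" "g t1 = t1" "g t2 = - t2"
    and h: "k_aut k h" "h b1 = b1" "h b2 = b2" "h b3 = b3" "h t1 = - t1"
    and s: "k_aut k s" "s b1 = b2" "s b2 = b3" "s b3 = b1"
    and nz: "t1 \<noteq> 0" "t2 \<noteq> 0" "(2::'a) \<noteq> 0"
  shows "k_rational k {y. g y = y \<and> h y = y \<and> s y = y}"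
proof -
  have Fs: "subfield F" by (simp add: F_def subfield_gen_field)
  have "g y = y" "h y = y" if "y \<in> F" for y
    using that k_aut_fixes_gen_field[OF g(1), of "{b1, b2, b3}"] k_aut_fixes_gen_field[OF h(1), of "{b1, b2, b3}"]
      g h by (auto simp: F_def)
  then have fixed: "{y. g y = y \<and> h y = y} = F"
    by (intro fixed_in_biquadratic_extension[OF Fs F g(1) _ g(5,6) h(1) _ h(5) nz]) auto
  have "F \<subseteq> alg_closure k {b1, b2, b3}" by (simp add: F_def gen_field_subset_alg_closure)
  moreover have "{t1, t2} \<subseteq> alg_closure k {b1, b2, b3}"
    using F(1,2) by (auto simp: F_def intro: sqrt_in_alg_closure)
  ultimately have "gen_field F {t1, t2} \<subseteq> alg_closure k {b1, b2, b3}"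
    by (intro gen_field_least subfield_alg_closure_gen)
  then have "alg_indep k [b1, b2, b3]"
    using F(3) by (intro alg_indep_if_spans[OF k ind]) auto
  from cyclic_fixed_field_rational[OF k this s] have "k_rational k (F \<inter> {y. s y = y})" by (simp add: F_def)
  also have "F \<inter> {y. s y = y} = {y. g y = y \<and> h y = y \<and> s y = y}" using fixed by auto
  finally show ?thesis .
qed

section \<open>Polynomial identities on the circle\<close>

context
  fixes p1 p2 p3 q1 q2 q3 c :: "'a::field"
  assumes circ: "p1^2 + q1^2 = c" "p2^2 + q2^2 = c" "p3^2 + q3^2 = c"
begin

text \<open>Rewrite rules that eliminate q_j^2, hence a normal form modulo the three circle
  equations. The second row reaches squares inside right-nested products.\<close>

lemma circle_reduce:
  "q1 * q1 = c - p1 * p1" "q2 * q2 = c - p2 * p2" "q3 * q3 = c - p3 * p3"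
  "q1 * (q1 * t) = (c - p1 * p1) * t" "q2 * (q2 * t) = (c - p2 * p2) * t" "q3 * (q3 * t) = (c - p3 * p3) * t"
  using circ by (simp_all add: power2_eq_square eq_diff_eq add.commute flip: mult.assoc)

text \<open>The equation R(v1, v2) = c after multiplication by both denominators, for the points v_j
  = (r_j, s_j) defined later. The following three identities likewise become linear relations
  between the v_j and the invariants.\<close>

lemma circle_pairing:
  "(q2*(p3*q1+c)) * (q3*(p1*q2+c)) + (p1*(p2*q3+c)) * (p2*(p3*q1+c))
    + (q2*(p3*q1+c)) * (p2*(p3*q1+c)) - (q3*(p1*q2+c)) * (p1*(p2*q3+c))
   = c * ((q1*p2+q1*q3+p2*p3) * (q2*p3+q2*q1+p3*p1))"
  by (simp add: circle_reduce algebra_simps power2_eq_square)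

lemma circle_u3: "p1*p2*p3 * (q2*(p3*q1+c)) + q1*q2*q3 * (p1*(p2*q3+c)) = c * (p1*q2) * (q1*p2+q1*q3+p2*p3)"
  by (simp add: circle_reduce algebra_simps power2_eq_square)

lemma circle_w0: "(p1*(p2*q3+c)) * (c - p2*q3 + p3*q1) - (q2*(p3*q1+c)) * (p1*q2) = p1*p2*p3 * (q1*p2+q1*q3+p2*p3)"
  by (simp add: circle_reduce algebra_simps power2_eq_square)

lemma circle_w1: "(q3*(p1*q2+c)) * (c + p3*q1 - p1*q2) - (p2*q3) * (p2*(p3*q1+c)) = q1*q2*q3 * (q2*p3+q2*q1+p3*p1)"
  by (simp add: circle_reduce algebra_simps power2_eq_square)

text \<open>Substitute p3^2 = c - q3^2 on the right and collect p2^2 + q2^2 = c. It recovers p1^2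
  from invariants.\<close>

lemma circle_p1: "p1^2 * (c^2 - (p2*q3)^2) = c * (p1*q2)^2 + (p1*p2*p3)^2"
  by (simp add: circle_reduce algebra_simps power2_eq_square)

end


section \<open>The case of sign 1\<close>

text \<open>With s^2 = a, let X, Y, Z be the images of x, y, z under t -> (t - s)/(t + s). The value
  is s (1 + w)/(1 - w) for w = Y Z / X. Over the common denominator, X + Y Z is even in s and X - Y
  Z is odd, so the factor s leaves only powers of a.\<close>

definition plus_gen :: "'a::field \<Rightarrow> 'a \<Rightarrow> 'a \<Rightarrow> 'a \<Rightarrow> 'a" where
  "plus_gen a x y z = (x*y*z + a*(x - y - z)) / (x*y + x*z - y*z - a)"

lemma plus_gen_swap: "plus_gen a x z y = plus_gen a x y z"
  by (simp add: plus_gen_def algebra_simps)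

lemma plus_gen_invert12:
  assumes "x \<noteq> 0" "y \<noteq> 0" "a \<noteq> 0" shows "plus_gen a (a / x) (a / y) z = plus_gen a x y z"
proof -
  let ?c = "- (a / (x * y))"
  have "(a/x)*(a/y)*z + a*(a/x - a/y - z) = ?c * (x*y*z + a*(x - y - z))"
    "(a/x)*(a/y) + (a/x)*z - (a/y)*z - a = ?c * (x*y + x*z - y*z - a)"
    using assms by (simp_all add: field_simps)
  then show ?thesis unfolding plus_gen_def using assms by (simp only: mult_divide_mult_cancel_left_if) simp
qed

lemma plus_gen_invert13:
  assumes "x \<noteq> 0" "z \<noteq> 0" "a \<noteq> 0" shows "plus_gen a (a / x) y (a / z) = plus_gen a x y z"
  using plus_gen_invert12[OF assms, of y] by (simp add: plus_gen_swap)

lemma plus_gen_invert23: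
  assumes "y \<noteq> 0" "z \<noteq> 0" "a \<noteq> 0" shows "plus_gen a x (a / y) (a / z) = plus_gen a x y z"
proof -
  let ?c = "a / (y * z)"
  have "x*(a/y)*(a/z) + a*(x - a/y - a/z) = ?c * (x*y*z + a*(x - y - z))"
    "x*(a/y) + x*(a/z) - (a/y)*(a/z) - a = ?c * (x*y + x*z - y*z - a)"
    using assms by (simp_all add: field_simps)
  then show ?thesis unfolding plus_gen_def using assms by (simp only: mult_divide_mult_cancel_left_if) simp
qed

text \<open>In the multiplicative coordinates the two generators are Y Z / X and Z X / Y, with
  product Z^2. Both sides equal 2 s (1 + Z^2)/(1 - Z^2), the right one by the addition formula for t
  -> s (1 + t)/(1 - t).\<close>

lemma plus_gen_sum:
  fixes x y z a :: "'a::field"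
  assumes "x*y + x*z - y*z - a \<noteq> 0" "y*z + y*x - z*x - a \<noteq> 0" "z \<noteq> 0"
    and "plus_gen a x y z + plus_gen a y z x \<noteq> 0"
  shows "z + a / z = 2 * (plus_gen a x y z * plus_gen a y z x + a) / (plus_gen a x y z + plus_gen a y z x)"
proof -
  define D1 where "D1 = x*y + x*z - y*z - a"
  define D2 where "D2 = y*z + y*x - z*x - a"
  define u where "u = plus_gen a x y z"
  define v where "v = plus_gen a y z x"
  have u: "D1 * u = x*y*z + a*(x - y - z)" using assms(1) by (simp add: u_def D1_def plus_gen_def)
  have v: "D2 * v = y*z*x + a*(y - z - x)" using assms(2) by (simp add: v_def D2_def plus_gen_def)
  have "(D1 * D2) * ((z^2 + a) * (u + v)) = (z^2 + a) * ((D1 * u) * D2 + D1 * (D2 * v))" by algebra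
  also have "\<dots> = 2 * z * ((D1 * u) * (D2 * v) + a * (D1 * D2))"
    unfolding u v unfolding D1_def D2_def by algebra
  also have "\<dots> = (D1 * D2) * (2 * z * (u * v + a))" by algebra
  finally have "(z^2 + a) * (u + v) = 2 * z * (u * v + a)" using assms(1,2) by (simp add: D1_def D2_def)
  moreover have "u + v \<noteq> 0" using assms(4) by (simp add: u_def v_def)
  ultimately have "z + a / z = 2 * (u * v + a) / (u + v)"
    using assms(3) by (simp add: field_simps power2_eq_square)
  then show ?thesis by (simp add: u_def v_def)
qed

lemma alg_indep_Cons_poly_nonzero:
  assumes "subfield k" "alg_indep k (x # xs)" "p \<in> polys_over k" "p \<noteq> 0"
  shows "poly p x \<noteq> 0"
  using assms(3,4) alg_indep_poly_nonzero[OF assms(1,2), of p] gen_field_base[of _ k "set xs"]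
  by (auto simp: polys_over_def)

theorem fixed_field_rational_plus:
  fixes k :: "'a::field set" and x1 x2 x3 a :: 'a
  assumes k: "subfield k" and two: "(2::'a) \<noteq> 0"
    and ind: "alg_indep k [x1, x2, x3]" and gen: "gen_field k {x1, x2, x3} = UNIV"
    and a: "a \<in> k" "a \<noteq> 0"
    and tau: "k_aut k tau" "tau x1 = a / x1" "tau x2 = a / x2" "tau x3 = x3"
    and lam: "k_aut k lam" "lam x1 = a / x1" "lam x2 = x2" "lam x3 = a / x3"
    and sig: "k_aut k sig" "sig x1 = x2" "sig x2 = x3" "sig x3 = x1"
  shows "k_rational k {y. tau y = y \<and> lam y = y \<and> sig y = y}"
proof -
  interpret specialisation k "[x1, x2, x3]" "[x1, x1, x1]"
    by unfold_locales (use k ind in auto)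
  have sx: "spec x1 x1" "spec x2 x1" "spec x3 x1"
    using spec_var[of 0] spec_var[of 1] spec_var[of 2] by simp_all
  note sa = spec_const[OF a(1)]
  have x10: "x1 \<noteq> 0"
    using alg_indep_Cons_poly_nonzero[OF k ind, of "[:0, 1:]"] k by (simp add: polys_over_pCons polys_over_0)
  have x1a: "x1 * x1 - a \<noteq> 0"
    using alg_indep_Cons_poly_nonzero[OF k ind, of "[:-a, 0, 1:]"] k a
    by (simp add: polys_over_pCons polys_over_0 subfield_uminus)
  have x0: "x1 \<noteq> 0" "x2 \<noteq> 0" "x3 \<noteq> 0" using spec_nonzero sx x10 by auto
  \<comment> \<open>On the diagonal the denominator of \<open>plus_gen\<close> becomes x1^2 - a, and
    its value becomes x1.\<close>
  have D: "x*y + x*z - y*z - a \<noteq> 0" and sw: "spec (plus_gen a x y z) x1"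
    if "spec x x1" "spec y x1" "spec z x1" for x y z
  proof -
    have "spec (x*y + x*z - y*z - a) (x1*x1 + x1*x1 - x1*x1 - a)" by (intro spec_intros that sa)
    then have s: "spec (x*y + x*z - y*z - a) (x1*x1 - a)" by simp
    then show "x*y + x*z - y*z - a \<noteq> 0" using spec_nonzero x1a by blast
    have "spec (x*y*z + a*(x - y - z)) (x1*x1*x1 + a*(x1 - x1 - x1))" by (intro spec_intros that sa)
    then have "spec (plus_gen a x y z) ((x1*x1*x1 + a*(x1 - x1 - x1)) / (x1*x1 - a))"
      unfolding plus_gen_def using s x1a by (intro spec_divide) auto
    also have "(x1*x1*x1 + a*(x1 - x1 - x1)) / (x1*x1 - a) = x1" using x1a by (simp add: field_simps)
    finally show "spec (plus_gen a x y z) x1" .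
  qed
  define w1 where "w1 = plus_gen a x1 x2 x3"
  define w2 where "w2 = plus_gen a x2 x3 x1"
  define w3 where "w3 = plus_gen a x3 x1 x2"
  define F where "F = gen_field k {w1, w2, w3}"
  have Fs: "subfield F" by (simp add: F_def subfield_gen_field)
  have wF: "w1 \<in> F" "w2 \<in> F" "w3 \<in> F" by (auto simp: F_def intro: gen_field_gen)
  have aF: "a \<in> F" using a by (simp add: F_def gen_field_base)
  have ws: "spec w1 x1" "spec w2 x1" "spec w3 x1" unfolding w1_def w2_def w3_def by (intro sw sx)+
  have "2 * x1 \<noteq> 0" using two x10 by simp
  then have w0: "w1 + w2 \<noteq> 0" "w2 + w3 \<noteq> 0"
    using spec_nonzero[OF spec_add[OF ws(1,2)]] spec_nonzero[OF spec_add[OF ws(2,3)]] by simp_all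
  have p3: "x3 + a / x3 \<in> F"
    using plus_gen_sum[OF D[OF sx(1,2,3)] D[OF sx(2,3,1)] x0(3)] w0 wF aF Fs
    by (auto simp: w1_def[symmetric] w2_def[symmetric] intro!: subfield_closed)
  have p1: "x1 + a / x1 \<in> F"
    using plus_gen_sum[OF D[OF sx(2,3,1)] D[OF sx(3,1,2)] x0(1)] w0 wF aF Fs
    by (auto simp: w3_def[symmetric] w2_def[symmetric] intro!: subfield_closed)
  \<comment> \<open>x3 and a/x3 are the roots of a quadratic polynomial over F with product a;
    \<open>t1\<close> is their difference, a square root of the discriminant. The same holds for
    \<open>t2\<close> and x1.\<close>
  define t1 where "t1 = x3 - a / x3"
  define t2 where "t2 = x1 - a / x1"
  have sq: "t1 ^ 2 = (x3 + a / x3) ^ 2 - 4 * a" "t2 ^ 2 = (x1 + a / x1) ^ 2 - 4 * a"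
    unfolding t1_def t2_def using x0 by (simp_all add: power2_eq_square field_simps)
  have sqF: "t1 ^ 2 \<in> F" "t2 ^ 2 \<in> F" unfolding sq using p1 p3 aF Fs by (auto intro!: subfield_closed)
  have t: "t1 \<noteq> 0" "t2 \<noteq> 0"
  proof -
    have "spec (x3 - a / x3) (x1 - a / x1)" "spec (x1 - a / x1) (x1 - a / x1)"
      using x10 by (auto intro!: spec_intros sx sa)
    moreover have "x1 - a / x1 \<noteq> 0" using x10 x1a by (simp add: field_simps)
    ultimately show "t1 \<noteq> 0" "t2 \<noteq> 0" unfolding t1_def t2_def using spec_nonzero by blast+
  qed
  let ?L = "gen_field F {t1, t2}"
  have L: "t1 \<in> ?L" "t2 \<in> ?L" "F \<subseteq> ?L" by (auto intro: gen_field_gen gen_field_base)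
  note Ls = subfield_gen_field[of F "{t1, t2}"]
  have "(x3 + a / x3 + t1) / 2 \<in> ?L" "(x1 + a / x1 + t2) / 2 \<in> ?L"
    using L p1 p3 by (intro subfield_divide[OF Ls subfield_add[OF Ls _ _] subfield_numeral[OF Ls]]; blast)+
  then have xL: "x3 \<in> ?L" "x1 \<in> ?L" using two by (simp_all add: t1_def t2_def flip: mult_2)
  \<comment> \<open>\<open>w1\<close> is a fractional linear function of x2 over k(x1, x3); this is
    the denominator of the inverse function, which recovers x2.\<close>
  have "spec (w1*x1 - w1*x3 - x1*x3 + a) (x1*x1 - x1*x1 - x1*x1 + a)" by (intro spec_intros ws sx sa)
  moreover have "x1*x1 - x1*x1 - x1*x1 + a \<noteq> 0" using x1a by auto
  ultimately have c0: "w1*x1 - w1*x3 - x1*x3 + a \<noteq> 0" using spec_nonzero by blast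
  have "(x1*x2 + x1*x3 - x2*x3 - a) * w1 = x1*x2*x3 + a*(x1 - x2 - x3)"
    using D[OF sx] by (simp add: w1_def plus_gen_def)
  then have "x2 * (w1*x1 - w1*x3 - x1*x3 + a) = a*x1 - a*x3 - w1*x1*x3 + w1*a" by algebra
  then have "x2 = (a*x1 - a*x3 - w1*x1*x3 + w1*a) / (w1*x1 - w1*x3 - x1*x3 + a)"
    using c0 by (simp add: eq_divide_eq)
  moreover have "\<dots> \<in> ?L" using xL wF aF L(3) by (intro subfield_closed[OF subfield_gen_field]) auto
  ultimately have "x2 \<in> ?L" by simp
  then have "gen_field k {x1, x2, x3} \<subseteq> ?L"
    using xL by (intro gen_field_least subfield_gen_field) (auto simp: F_def intro: gen_field_base)
  then have UL: "?L = UNIV" using gen by auto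
  note ks = k_aut_simps[OF tau(1)] k_aut_simps[OF lam(1)] k_aut_simps[OF sig(1)]
  have tw: "tau w1 = w1" "tau w2 = w2" "tau w3 = w3"
  proof -
    have "tau (plus_gen a x y z) = plus_gen a (tau x) (tau y) (tau z)" for x y z
      by (simp add: plus_gen_def ks a)
    then show "tau w1 = w1" "tau w2 = w2" "tau w3 = w3"
      using x0 a by (simp_all add: w1_def w2_def w3_def tau plus_gen_invert12 plus_gen_invert13 plus_gen_invert23)
  qed
  have lw: "lam w1 = w1" "lam w2 = w2" "lam w3 = w3"
  proof -
    have "lam (plus_gen a x y z) = plus_gen a (lam x) (lam y) (lam z)" for x y z
      by (simp add: plus_gen_def ks a)
    then show "lam w1 = w1" "lam w2 = w2" "lam w3 = w3"
      using x0 a by (simp_all add: w1_def w2_def w3_def lam plus_gen_invert12 plus_gen_invert13 plus_gen_invert23)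
  qed
  have swp: "sig w1 = w2" "sig w2 = w3" "sig w3 = w1"
  proof -
    have "sig (plus_gen a x y z) = plus_gen a (sig x) (sig y) (sig z)" for x y z
      by (simp add: plus_gen_def ks a)
    then show "sig w1 = w2" "sig w2 = w3" "sig w3 = w1" by (simp_all add: w1_def w2_def w3_def sig)
  qed
  have "tau t1 = t1" "tau t2 = - t2" "lam t1 = - t1"
    using x0 a by (simp_all add: t1_def t2_def ks tau lam)
  then show ?thesis
    using sqF UL unfolding F_def
    by (intro rational_if_biquadratic_over_cyclic[OF k ind _ _ _ tau(1) tw _ _ lam(1) lw _ sig(1) swp t two]) auto
qed


section \<open>Three points on a circle\<close>

text \<open>Cramer's rule for a cyclic system, whose determinant is
  \<open>m1*m2*m3 + n1*n2*n3\<close>. The other unknowns follow by rotating the indices.\<close>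

lemma linear_cycle_solution:
  fixes t1 t2 t3 :: "'a::field"
  assumes F: "subfield F" "m1 \<in> F" "m2 \<in> F" "m3 \<in> F" "n1 \<in> F" "n2 \<in> F" "n3 \<in> F" "h1 \<in> F" "h2 \<in> F" "h3 \<in> F"
    and det: "m1*m2*m3 + n1*n2*n3 \<noteq> 0"
    and eq: "m2*t1 + n1*t2 = h1" "m3*t2 + n2*t3 = h2" "m1*t3 + n3*t1 = h3"
  shows "t1 \<in> F"
proof -
  have "t1 * (m1*m2*m3 + n1*n2*n3) = m1*(h1*m3 - n1*h2) + n1*n2*h3"
    unfolding eq[symmetric] by algebra
  then have "t1 = (m1*(h1*m3 - n1*h2) + n1*n2*h3) / (m1*m2*m3 + n1*n2*n3)"
    using det by (simp add: nonzero_eq_divide_eq)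
  also have "\<dots> \<in> F" using F by (intro subfield_closed)
  finally show ?thesis .
qed

lemma linear_pair_solution:
  fixes w0 w1 :: "'a::field"
  assumes F: "subfield F" "a \<in> F" "b \<in> F" "c \<in> F" "d \<in> F" "e \<in> F" "f \<in> F"
    and det: "a*d - b*c \<noteq> 0" and eq: "a*w0 + b*w1 = e" "c*w0 + d*w1 = f"
  shows "w0 \<in> F" "w1 \<in> F"
proof -
  have "w0 * (a*d - b*c) = d*e - b*f" "w1 * (a*d - b*c) = a*f - c*e"
    unfolding eq[symmetric] by algebra+
  then have "w0 = (d*e - b*f) / (a*d - b*c)" "w1 = (a*f - c*e) / (a*d - b*c)"
    using det by (simp_all add: nonzero_eq_divide_eq)
  moreover have "(d*e - b*f) / (a*d - b*c) \<in> F" "(a*f - c*e) / (a*d - b*c) \<in> F"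
    using F by (intro subfield_closed; simp)+
  ultimately show "w0 \<in> F" "w1 \<in> F" by simp_all
qed

text \<open>With \<open>v\<^sub>j = (r\<^sub>j, s\<^sub>j)\<close> and the bilinear form \<open>R(v,w) = v \<bullet> w + det(v,w)\<close>, the fixed field of the
  Klein four group is the function field of the variety \<open>R(v\<^sub>1,v\<^sub>2) = R(v\<^sub>2,v\<^sub>3) = R(v\<^sub>3,v\<^sub>1) = c\<close>.
  As \<open>v\<^sub>0 = (-al, -be)\<close> satisfies \<open>R(v\<^sub>0,v\<^sub>0) = c\<close>, the slopes \<open>b\<^sub>j\<close> of the lines from \<open>v\<^sub>0\<close> to \<open>v\<^sub>j\<close>
  parametrise it: in terms of the inverse distances, the three equations become linear.\<close>

lemma slope_equation:
  fixes c :: "'a::field"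
  assumes "r1*r2 + s1*s2 + r1*s2 - r2*s1 = c" "al^2 + be^2 = c"
    and "r1 = b1 * y1 - al" "s1 = y1 - be" "r2 = b2 * y2 - al" "s2 = y2 - be" "y1 \<noteq> 0" "y2 \<noteq> 0"
  shows "(- al*b2 - be - al + be*b2) * (1/y1) + (- al*b1 - be + al - be*b1) * (1/y2)
    = - (b1*b2 + 1 + b1 - b2)"
proof -
  have "(- al*b2 - be - al + be*b2) * y2 + (- al*b1 - be + al - be*b1) * y1 = - (b1*b2 + 1 + b1 - b2) * (y1*y2)"
    using assms(1) unfolding assms(2)[symmetric] assms(3-6) by algebra
  then show ?thesis using assms(7,8) by (simp add: field_simps)
qed

text \<open>The common setting of the three cases for \<open>eps = -1\<close>. The signs under
  \<open>g\<close> and \<open>h\<close> agree on p1 and q2, on p2 and q3, and on p3 and q1; these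
  pairs carry the three nontrivial characters of the Klein four group. The point
  \<open>(al, be)\<close> is the rational point of the circle.\<close>

locale circle_action = specialisation k "[x1, x2, x3]" "[x1, x1, x1]"
  for k :: "'a::field set" and x1 x2 x3 +
  fixes p1 p2 p3 q1 q2 q3 c al be :: 'a and g h s :: "'a \<Rightarrow> 'a"
  assumes two: "(2::'a) \<noteq> 0"
    and const: "c \<in> k" "al \<in> k" "be \<in> k" "c \<noteq> 0" "al^2 + be^2 = c"
    and circle: "p1^2 + q1^2 = c" "p2^2 + q2^2 = c" "p3^2 + q3^2 = c"
    and gen_x: "gen_field k {x1, x2, x3} = UNIV"
    and x_gen: "x1 \<in> gen_field k {p1, q1}" "x2 \<in> gen_field k {p2, q2}" "x3 \<in> gen_field k {p3, q3}"
    and spec_p: "spec p1 p1" "spec p2 p1" "spec p3 p1" and spec_q: "spec q1 q1" "spec q2 q1" "spec q3 q1"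
    and g: "k_aut k g" "g p1 = p1" "g q1 = - q1" "g p2 = - p2" "g q2 = q2" "g p3 = - p3" "g q3 = - q3"
    and h: "k_aut k h" "h p1 = - p1" "h q1 = q1" "h p2 = - p2" "h q2 = - q2" "h p3 = p3" "h q3 = - q3"
    and s: "k_aut k s" "s p1 = p2" "s p2 = p3" "s p3 = p1" "s q1 = q2" "s q2 = q3" "s q3 = q1"
begin

lemma gen: "gen_field k {p1, p2, p3, q1, q2, q3} = UNIV"
proof -
  have "{x1, x2, x3} \<subseteq> gen_field k {p1, p2, p3, q1, q2, q3}"
    using x_gen gen_field_mono[of "{p1, q1}" "{p1, p2, p3, q1, q2, q3}" k]
      gen_field_mono[of "{p2, q2}" "{p1, p2, p3, q1, q2, q3}" k]
      gen_field_mono[of "{p3, q3}" "{p1, p2, p3, q1, q2, q3}" k] by auto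
  then have "gen_field k {x1, x2, x3} \<subseteq> gen_field k {p1, p2, p3, q1, q2, q3}"
    by (intro gen_field_least subfield_gen_field) (auto intro: gen_field_base)
  then show ?thesis using gen_x by auto
qed

text \<open>If \<open>p1\<close> were algebraic over k, the circle equation would make
  \<open>q1\<close> algebraic, and with them \<open>x1\<close>, which lies in k(p1, q1).\<close>

lemma p1_trans: "p1 \<notin> alg_closure k {}"
proof
  assume p: "p1 \<in> alg_closure k {}"
  note cl = subfield_closed[OF subfield_alg_closure_gen]
  have kc: "k \<subseteq> alg_closure k {}" using gen_field_subset_alg_closure gen_field_base by blast
  have "c - p1^2 \<in> alg_closure k {}" using p kc const(1) by (intro cl) auto
  moreover have "c - p1^2 = q1^2" using circle(1) by (simp add: diff_eq_eq add.commute)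
  ultimately have "q1^2 \<in> alg_closure k {}" by simp
  then have "q1 \<in> alg_closure k (alg_closure k {})"
    by (rule sqrt_in_alg_closure[OF gen_field_gen])
  then have "q1 \<in> alg_closure k {}" using alg_closure_least[OF order_refl] by blast
  then have "gen_field k {p1, q1} \<subseteq> alg_closure k {}"
    using p kc by (intro gen_field_least subfield_alg_closure_gen) auto
  then have "x1 \<in> alg_closure k (set [x2, x3])" using x_gen(1) alg_closure_mono[of "{}" "set [x2, x3]" k] by auto
  then show False using indep alg_indep_Cons[OF subfield_k] by blast
qed

lemma p1_root: assumes "P \<in> polys_over k" "P \<noteq> 0" shows "poly P p1 \<noteq> 0"
  using p1_trans assms by (auto simp: alg_closure_def alg_over_def gen_field_empty[OF subfield_k])

lemmas k_closed = subfield_closed[OF subfield_k]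

lemma p1_nz: "p1 \<noteq> 0" and p1_be: "p1 + be \<noteq> 0" and pq: "p1*q1 + c \<noteq> 0" "p1*q1 - c \<noteq> 0"
proof -
  note cl = polys_over_pCons polys_over_0[OF subfield_k]
  have m: "0 \<in> k" "1 \<in> k" "- c \<in> k" "be \<in> k" "c^2 \<in> k" "- 1 \<in> k" using const by (auto intro!: k_closed)
  show "p1 \<noteq> 0" using p1_root[of "[:0, 1:]"] m by (simp add: cl)
  show "p1 + be \<noteq> 0" using p1_root[of "[:be, 1:]"] m by (simp add: cl add.commute)
  \<comment> \<open>On the circle c^2 - (p1 q1)^2 = p1^4 - c p1^2 + c^2, a nonzero polynomial in
    \<open>p1\<close> alone.\<close>
  have "poly [:c^2, 0, - c, 0, 1:] p1 \<noteq> 0" by (rule p1_root) (use m in \<open>simp_all add: cl\<close>)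
  moreover have "poly [:c^2, 0, - c, 0, 1:] p1 = - ((p1*q1 + c) * (p1*q1 - c))"
    using circle(1) by (simp add: algebra_simps power2_eq_square circle_reduce[OF circle])
  ultimately have "(p1*q1 + c) * (p1*q1 - c) \<noteq> 0" by (metis neg_equal_0_iff_equal)
  then show "p1*q1 + c \<noteq> 0" "p1*q1 - c \<noteq> 0" by (metis mult_eq_0_iff)+
qed

text \<open>Eliminating \<open>q1\<close> from a constant value of the form leaves a quadratic
  equation for \<open>p1\<close> with leading coefficient al^2 + be^2 = c, which is nonzero.\<close>

lemma linear_form_nonconstant: assumes "m \<in> k" shows "al*q1 + be*p1 \<noteq> m"
proof
  assume e: "al*q1 + be*p1 = m"
  have "poly [:m^2 - al^2*c, - 2*m*be, c:] p1 = 0"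
  proof -
    have "(m - be*p1)^2 = al^2 * q1^2" unfolding e[symmetric] by algebra
    also have "q1^2 = c - p1^2" using circle(1) by (simp add: eq_diff_eq add.commute)
    finally have "m^2 - al^2*c - 2*m*be*p1 + (al^2 + be^2)*p1^2 = 0" by algebra
    then show ?thesis unfolding const(5) by (simp add: algebra_simps power2_eq_square)
  qed
  moreover have "poly [:m^2 - al^2*c, - 2*m*be, c:] p1 \<noteq> 0"
  proof (rule p1_root)
    have "m^2 - al^2*c \<in> k" "- 2*m*be \<in> k" using assms const by (auto intro!: k_closed)
    then show "[:m^2 - al^2*c, - 2*m*be, c:] \<in> polys_over k"
      using const by (simp add: polys_over_pCons polys_over_0[OF subfield_k])
  qed (use const in simp)
  ultimately show False by simp
qed

text \<open>Every term of \<open>G1\<close> transforms under the Klein four group like p1 and q2,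
  while p3 q1 and p2 q3 are invariant; so \<open>r1\<close> and \<open>s1\<close> are invariant, and
  the others follow by rotation. On the diagonal each \<open>G\<close> becomes p1 q1 + c, and each
  point (r_j, s_j) becomes (q1, p1).\<close>

definition "G1 = q1*p2 + q1*q3 + p2*p3"
definition "G2 = q2*p3 + q2*q1 + p3*p1"
definition "G3 = q3*p1 + q3*q2 + p1*p2"
definition "r1 = q2*(p3*q1 + c) / G1"
definition "r2 = q3*(p1*q2 + c) / G2"
definition "r3 = q1*(p2*q3 + c) / G3"
definition "s1 = p1*(p2*q3 + c) / G1"
definition "s2 = p2*(p3*q1 + c) / G2"
definition "s3 = p3*(p1*q2 + c) / G3"
definition "b1 = (r1 + al) / (s1 + be)"
definition "b2 = (r2 + al) / (s2 + be)"
definition "b3 = (r3 + al) / (s3 + be)"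
definition "F = gen_field k {b1, b2, b3}"

lemma spec_G: "spec G1 (p1*q1 + c)" "spec G2 (p1*q1 + c)" "spec G3 (p1*q1 + c)"
proof -
  have e: "q1*p1 + q1*q1 + p1*p1 = p1*q1 + c" using circle(1) by (simp add: power2_eq_square algebra_simps)
  have "spec G1 (q1*p1 + q1*q1 + p1*p1)" "spec G2 (q1*p1 + q1*q1 + p1*p1)" "spec G3 (q1*p1 + q1*q1 + p1*p1)"
    unfolding G1_def G2_def G3_def by (intro spec_intros spec_p spec_q)+
  then show "spec G1 (p1*q1 + c)" "spec G2 (p1*q1 + c)" "spec G3 (p1*q1 + c)" unfolding e .
qed

lemma G_nz: "G1 \<noteq> 0" "G2 \<noteq> 0" "G3 \<noteq> 0"
  using spec_G spec_nonzero pq(1) by blast+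

lemma spec_r: "spec r1 q1" "spec r2 q1" "spec r3 q1"
proof -
  have "q1 * (p1*q1 + c) / (p1*q1 + c) = q1" using pq by simp
  moreover have "spec r1 (q1 * (p1*q1 + c) / (p1*q1 + c))" "spec r2 (q1 * (p1*q1 + c) / (p1*q1 + c))"
    "spec r3 (q1 * (p1*q1 + c) / (p1*q1 + c))"
    unfolding r1_def r2_def r3_def by (intro spec_intros spec_p spec_q spec_G spec_const const pq)+
  ultimately show "spec r1 q1" "spec r2 q1" "spec r3 q1" by simp_all
qed

lemma spec_s: "spec s1 p1" "spec s2 p1" "spec s3 p1"
proof -
  have "p1 * (p1*q1 + c) / (p1*q1 + c) = p1" using pq by simp
  moreover have "spec s1 (p1 * (p1*q1 + c) / (p1*q1 + c))" "spec s2 (p1 * (p1*q1 + c) / (p1*q1 + c))"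
    "spec s3 (p1 * (p1*q1 + c) / (p1*q1 + c))"
    unfolding s1_def s2_def s3_def by (intro spec_intros spec_p spec_q spec_G spec_const const pq)+
  ultimately show "spec s1 p1" "spec s2 p1" "spec s3 p1" by simp_all
qed

lemma s_be: "s1 + be \<noteq> 0" "s2 + be \<noteq> 0" "s3 + be \<noteq> 0"
  using spec_nonzero[OF spec_add[OF _ spec_const] p1_be] spec_s const by blast+

lemma spec_b: "spec b1 ((q1 + al) / (p1 + be))" "spec b2 ((q1 + al) / (p1 + be))" "spec b3 ((q1 + al) / (p1 + be))"
  unfolding b1_def b2_def b3_def by (intro spec_intros spec_r spec_s spec_const const p1_be)+

lemma pairing:
  "r1*r2 + s1*s2 + r1*s2 - r2*s1 = c" "r2*r3 + s2*s3 + r2*s3 - r3*s2 = c" "r3*r1 + s3*s1 + r3*s1 - r1*s3 = c"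
proof -
  have *: "A / X * (B / Y) + C / X * (D / Y) + A / X * (D / Y) - B / Y * (C / X) = c"
    if "A*B + C*D + A*D - B*C = c * (X*Y)" "X \<noteq> 0" "Y \<noteq> 0" for A B C D X Y
    using that by (simp add: add_divide_distrib[symmetric] diff_divide_distrib[symmetric] mult.commute)
  show "r1*r2 + s1*s2 + r1*s2 - r2*s1 = c"
    unfolding r1_def r2_def s1_def s2_def
    by (rule *[OF _ G_nz(1,2)]) (use circle_pairing[OF circle] in \<open>simp add: G1_def G2_def\<close>)
  show "r2*r3 + s2*s3 + r2*s3 - r3*s2 = c"
    unfolding r2_def r3_def s2_def s3_def
    by (rule *[OF _ G_nz(2,3)]) (use circle_pairing[OF circle(2,3,1)] in \<open>simp add: G2_def G3_def\<close>)
  show "r3*r1 + s3*s1 + r3*s1 - r1*s3 = c"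
    unfolding r3_def r1_def s3_def s1_def
    by (rule *[OF _ G_nz(3,1)]) (use circle_pairing[OF circle(3,1,2)] in \<open>simp add: G3_def G1_def\<close>)
qed

section \<open>Recovery of the invariants from the three slopes\<close>

lemma subfield_F: "subfield F" by (simp add: F_def subfield_gen_field)

lemma F_const: "x \<in> k \<Longrightarrow> x \<in> F" by (simp add: F_def gen_field_base)

lemma b_F: "b1 \<in> F" "b2 \<in> F" "b3 \<in> F" by (auto simp: F_def intro: gen_field_gen)

lemma rs_F: "r1 \<in> F" "r2 \<in> F" "r3 \<in> F" "s1 \<in> F" "s2 \<in> F" "s3 \<in> F"
proof -
  define m where "m = (\<lambda>b. - al*b - be - al + be*b)"
  define n where "n = (\<lambda>b. - al*b - be + al - be*b)"
  define e where "e = (\<lambda>b b' :: 'a. - (b*b' + 1 + b - b'))"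
  have mF: "m b \<in> F" "n b \<in> F" if "b \<in> F" for b
    unfolding m_def n_def using that F_const[OF const(2)] F_const[OF const(3)]
    by (auto intro!: subfield_closed[OF subfield_F])
  have eF: "e b b' \<in> F" if "b \<in> F" "b' \<in> F" for b b'
    unfolding e_def using that by (auto intro!: subfield_closed[OF subfield_F])
  have r: "r1 = b1 * (s1 + be) - al" "r2 = b2 * (s2 + be) - al" "r3 = b3 * (s3 + be) - al"
    using s_be by (simp_all add: b1_def b2_def b3_def)
  have s: "s1 = (s1 + be) - be" "s2 = (s2 + be) - be" "s3 = (s3 + be) - be" by simp_all
  have eqs: "m b2 * (1 / (s1 + be)) + n b1 * (1 / (s2 + be)) = e b1 b2"
    "m b3 * (1 / (s2 + be)) + n b2 * (1 / (s3 + be)) = e b2 b3"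
    "m b1 * (1 / (s3 + be)) + n b3 * (1 / (s1 + be)) = e b3 b1"
    unfolding m_def n_def e_def
    by (rule slope_equation[OF pairing(1) const(5) r(1) s(1) r(2) s(2) s_be(1,2)]
          slope_equation[OF pairing(2) const(5) r(2) s(2) r(3) s(3) s_be(2,3)]
          slope_equation[OF pairing(3) const(5) r(3) s(3) r(1) s(1) s_be(3,1)])+
  \<comment> \<open>On the diagonal the determinant is m^3 + n^3. With S = al q1 + be p1 and T = be
    q1 - al p1, so that T^2 = c^2 - S^2, it equals 4 (S + c)^2 (S - 2c) up to the factor (p1 +
    be)^3. A linear form that is not constant cannot make this vanish.\<close>
  have det: "m b1 * m b2 * m b3 + n b1 * n b2 * n b3 \<noteq> 0"
  proof (rule spec_nonzero)
    let ?b = "(q1 + al) / (p1 + be)"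
    show "spec (m b1 * m b2 * m b3 + n b1 * n b2 * n b3) (m ?b * m ?b * m ?b + n ?b * n ?b * n ?b)"
      unfolding m_def n_def by (intro spec_intros spec_b spec_const const)
    let ?S = "al*q1 + be*p1"
    have mn: "m ?b * (p1 + be) = (be*q1 - al*p1) - (?S + c)" "n ?b * (p1 + be) = - (be*q1 - al*p1) - (?S + c)"
    proof -
      have b: "?b * (p1 + be) = q1 + al" using p1_be by simp
      have "m ?b * (p1 + be) = (be - al) * (?b * (p1 + be)) - (be + al) * (p1 + be)"
        "n ?b * (p1 + be) = (al - be) * (p1 + be) - (al + be) * (?b * (p1 + be))"
        unfolding m_def n_def by algebra+
      then show "m ?b * (p1 + be) = (be*q1 - al*p1) - (?S + c)" "n ?b * (p1 + be) = - (be*q1 - al*p1) - (?S + c)"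
        unfolding b const(5)[symmetric] by algebra+
    qed
    have "(be*q1 - al*p1)^2 = (al^2 + be^2) * (p1^2 + q1^2) - ?S^2" by algebra
    then have "(be*q1 - al*p1)^2 = c^2 - ?S^2"
      unfolding circle(1) const(5) power2_eq_square[of c] .
    then have "(m ?b * m ?b * m ?b + n ?b * n ?b * n ?b) * (p1 + be)^3 = 4 * (?S + c)^2 * (?S - 2*c)"
      using mn by algebra
    moreover have "4 * (?S + c)^2 * (?S - 2*c) \<noteq> 0"
    proof -
      have "?S \<noteq> - c" "?S \<noteq> 2*c" using const by (auto intro!: linear_form_nonconstant k_closed)
      moreover have "(4::'a) \<noteq> 0" using two by (metis mult_2 mult_eq_0_iff numeral_Bit0)
      ultimately show ?thesis by (simp add: eq_neg_iff_add_eq_0)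
    qed
    ultimately show "m ?b * m ?b * m ?b + n ?b * n ?b * n ?b \<noteq> 0" by auto
  qed
  have inv: "1 / (s1 + be) \<in> F" "1 / (s2 + be) \<in> F" "1 / (s3 + be) \<in> F"
  proof -
    show "1 / (s1 + be) \<in> F"
      using det by (intro linear_cycle_solution[OF subfield_F mF(1)[OF b_F(1)] mF(1)[OF b_F(2)] mF(1)[OF b_F(3)]
          mF(2)[OF b_F(1)] mF(2)[OF b_F(2)] mF(2)[OF b_F(3)] eF[OF b_F(1,2)] eF[OF b_F(2,3)] eF[OF b_F(3,1)] _ eqs])
    show "1 / (s2 + be) \<in> F"
      using det by (intro linear_cycle_solution[OF subfield_F mF(1)[OF b_F(2)] mF(1)[OF b_F(3)] mF(1)[OF b_F(1)]
          mF(2)[OF b_F(2)] mF(2)[OF b_F(3)] mF(2)[OF b_F(1)] eF[OF b_F(2,3)] eF[OF b_F(3,1)] eF[OF b_F(1,2)] _ eqs(2,3,1)])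
        (simp add: ac_simps)
    show "1 / (s3 + be) \<in> F"
      using det by (intro linear_cycle_solution[OF subfield_F mF(1)[OF b_F(3)] mF(1)[OF b_F(1)] mF(1)[OF b_F(2)]
          mF(2)[OF b_F(3)] mF(2)[OF b_F(1)] mF(2)[OF b_F(2)] eF[OF b_F(3,1)] eF[OF b_F(1,2)] eF[OF b_F(2,3)] _ eqs(3,1,2)])
        (simp add: ac_simps)
  qed
  have "t \<in> F" if "1 / (t + be) \<in> F" for t
  proof -
    have "inverse (1 / (t + be)) - be \<in> F"
      using subfield_diff[OF subfield_F subfield_inverse[OF subfield_F that] F_const[OF const(3)]] .
    then show ?thesis by simp
  qed
  then show sF: "s1 \<in> F" "s2 \<in> F" "s3 \<in> F" using inv by blast+
  show "r1 \<in> F" "r2 \<in> F" "r3 \<in> F"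
    using sF b_F F_const[OF const(2)] F_const[OF const(3)]
    by (subst r; auto intro!: subfield_closed[OF subfield_F])+
qed

lemma w_relations:
  "p1*p2*p3 * r1 + q1*q2*q3 * s1 = c * (p1*q2)" "p1*p2*p3 * r2 + q1*q2*q3 * s2 = c * (p2*q3)"
  "p1*p2*p3 * r3 + q1*q2*q3 * s3 = c * (p3*q1)"
  "s1 * (c - p2*q3 + p3*q1) - r1 * (p1*q2) = p1*p2*p3"
  "r2 * (c + p3*q1 - p1*q2) - s2 * (p2*q3) = q1*q2*q3"
proof -
  show "p1*p2*p3 * r1 + q1*q2*q3 * s1 = c * (p1*q2)"
    using circle_u3[OF circle] G_nz(1) by (simp add: r1_def s1_def add_divide_distrib[symmetric] divide_eq_eq G1_def)
  show "p1*p2*p3 * r2 + q1*q2*q3 * s2 = c * (p2*q3)"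
    using circle_u3[OF circle(2,3,1)] G_nz(2)
    by (simp add: r2_def s2_def add_divide_distrib[symmetric] divide_eq_eq G2_def ac_simps)
  show "p1*p2*p3 * r3 + q1*q2*q3 * s3 = c * (p3*q1)"
    using circle_u3[OF circle(3,1,2)] G_nz(3)
    by (simp add: r3_def s3_def add_divide_distrib[symmetric] divide_eq_eq G3_def ac_simps)
  show "s1 * (c - p2*q3 + p3*q1) - r1 * (p1*q2) = p1*p2*p3"
    using circle_w0[OF circle] G_nz(1)
    by (simp add: r1_def s1_def diff_divide_distrib[symmetric] divide_eq_eq G1_def)
  show "r2 * (c + p3*q1 - p1*q2) - s2 * (p2*q3) = q1*q2*q3"
    using circle_w1[OF circle] G_nz(2)
    by (simp add: r2_def s2_def diff_divide_distrib[symmetric] divide_eq_eq G2_def ac_simps)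
qed

lemma invariants_F: "p1*p2*p3 \<in> F" "q1*q2*q3 \<in> F" "p1*q2 \<in> F" "p2*q3 \<in> F" "p3*q1 \<in> F"
proof -
  \<comment> \<open>The first three relations of \<open>w_relations\<close> express c times p1 q2,
    p2 q3 and p3 q1 linearly through p1 p2 p3 and q1 q2 q3. Inserted into the last two, multiplied
    by c, they leave two linear equations with these coefficients.\<close>
  let ?a = "c + s1*(r2 - r3) + r1*r1" and ?b = "s1*(s2 - s3) + r1*s1"
  let ?c = "r2*s2 - r3*r2 + r1*r2" and ?d = "c + s2*s2 - s3*r2 + s1*r2"
  have eq: "?a * (p1*p2*p3) + ?b * (q1*q2*q3) = c*c*s1" "?c * (p1*p2*p3) + ?d * (q1*q2*q3) = c*c*r2"
    using w_relations by algebra+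
  have cF: "c \<in> F" using F_const const by blast
  have abF: "?a \<in> F" "?b \<in> F" "?c \<in> F" "?d \<in> F" "c*c*s1 \<in> F" "c*c*r2 \<in> F"
    using rs_F cF by (auto intro!: subfield_closed[OF subfield_F])
  have det: "?a * ?d - ?b * ?c \<noteq> 0"
  proof (rule spec_nonzero)
    show "spec (?a * ?d - ?b * ?c) ((c + p1*(q1 - q1) + q1*q1) * (c + p1*p1 - p1*q1 + p1*q1)
        - (p1*(p1 - p1) + q1*p1) * (q1*p1 - q1*q1 + q1*q1))"
      by (intro spec_intros spec_r spec_s spec_const const)
    have "(c + p1*(q1 - q1) + q1*q1) * (c + p1*p1 - p1*q1 + p1*q1)
        - (p1*(p1 - p1) + q1*p1) * (q1*p1 - q1*q1 + q1*q1) = c * c + c * (p1^2 + q1^2)"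
      by algebra
    also have "\<dots> = 2 * c * c" unfolding circle(1) by simp
    \<comment> \<open>This is where characteristic 2 must be excluded for the 2-by-2 system.\<close>
    also have "\<dots> \<noteq> 0" using two const by simp
    finally show "(c + p1*(q1 - q1) + q1*q1) * (c + p1*p1 - p1*q1 + p1*q1)
        - (p1*(p1 - p1) + q1*p1) * (q1*p1 - q1*q1 + q1*q1) \<noteq> 0" .
  qed
  show w: "p1*p2*p3 \<in> F" "q1*q2*q3 \<in> F"
    using linear_pair_solution[OF subfield_F abF det eq] by blast+
  have "t \<in> F" if "p1*p2*p3 * r + q1*q2*q3 * s = c * t" "r \<in> F" "s \<in> F" for t r s
  proof -
    have "t = (p1*p2*p3 * r + q1*q2*q3 * s) / c" using that(1) const by simp
    also have "\<dots> \<in> F"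
      by (rule subfield_divide[OF subfield_F subfield_add[OF subfield_F
            subfield_mult[OF subfield_F w(1) that(2)] subfield_mult[OF subfield_F w(2) that(3)]] cF])
    finally show ?thesis .
  qed
  then show "p1*q2 \<in> F" "p2*q3 \<in> F" "p3*q1 \<in> F" using w_relations(1-3) rs_F by blast+
qed

lemma p_sq_F: "p1^2 \<in> F" "p2^2 \<in> F"
proof -
  have *: "p^2 \<in> F" if "p^2 * (c^2 - u^2) = c * v^2 + w^2" "spec u (p1*q1)" "u \<in> F" "v \<in> F" "w \<in> F" for p u v w
  proof -
    have "spec (c^2 - u^2) (c^2 - (p1*q1)^2)" by (intro spec_intros spec_const const that(2))
    moreover have "c^2 - (p1*q1)^2 = - (p1*q1 + c) * (p1*q1 - c)" by algebra
    ultimately have "c^2 - u^2 \<noteq> 0" using spec_nonzero pq by (metis mult_eq_0_iff neg_equal_0_iff_equal)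
    then have "p^2 = (c * v^2 + w^2) / (c^2 - u^2)" using that(1) by (simp add: nonzero_eq_divide_eq)
    also have "\<dots> \<in> F" using that F_const[OF const(1)] by (intro subfield_closed[OF subfield_F])
    finally show ?thesis .
  qed
  show "p1^2 \<in> F"
    by (rule *[OF circle_p1[OF circle]]) (intro invariants_F spec_mult spec_p spec_q)+
  have "p2*p3*p1 \<in> F" using invariants_F(1) by (simp add: ac_simps)
  then show "p2^2 \<in> F"
    by (intro *[OF circle_p1[OF circle(2,3,1)]]) (intro invariants_F spec_mult spec_p spec_q)+
qed

theorem fixed_field_rational: "k_rational k {y. g y = y \<and> h y = y \<and> s y = y}"
proof -
  have p_nz: "p1 \<noteq> 0" "p2 \<noteq> 0" "p3 \<noteq> 0" using spec_nonzero spec_p p1_nz by blast+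
  let ?L = "gen_field F {p1, p2}"
  have FL: "F \<subseteq> ?L" by (auto intro: gen_field_base)
  have pL: "p1 \<in> ?L" "p2 \<in> ?L" by (auto intro: gen_field_gen)
  have uL: "p1*p2*p3 \<in> ?L" "p1*q2 \<in> ?L" "p2*q3 \<in> ?L" "p3*q1 \<in> ?L" using invariants_F FL by blast+
  \<comment> \<open>\<open>p1\<close> and \<open>p2\<close> are the two square roots to adjoin:
    every other coordinate is an invariant divided by coordinates already obtained.\<close>
  have "p1*p2*p3 / (p1*p2) \<in> ?L" "p1*q2 / p1 \<in> ?L" "p2*q3 / p2 \<in> ?L" 
    using uL pL subfield_divide[OF subfield_gen_field] subfield_mult[OF subfield_gen_field] by blast+
  then have L2: "p3 \<in> ?L" "q2 \<in> ?L" "q3 \<in> ?L" using p_nz by simp_all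
  then have "p3*q1 / p3 \<in> ?L" using uL subfield_divide[OF subfield_gen_field] by blast
  then have "q1 \<in> ?L" using p_nz by simp
  then have "gen_field k {p1, p2, p3, q1, q2, q3} \<subseteq> ?L"
    using L2 pL FL F_const by (intro gen_field_least subfield_gen_field) auto
  then have U: "?L = UNIV" using gen by auto
  note gs = k_aut_simps[OF g(1)] and hs = k_aut_simps[OF h(1)] and ss = k_aut_simps[OF s(1)]
  note defs = b1_def b2_def b3_def r1_def r2_def r3_def s1_def s2_def s3_def
  have gG: "g G1 = G1" "g G2 = - G2" "g G3 = - G3"
    unfolding G1_def G2_def G3_def by (simp_all add: gs g algebra_simps)
  have hG: "h G1 = - G1" "h G2 = - G2" "h G3 = G3"
    unfolding G1_def G2_def G3_def by (simp_all add: hs h algebra_simps)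
  have sG: "s G1 = G2" "s G2 = G3" "s G3 = G1"
    unfolding G1_def G2_def G3_def by (simp_all add: ss s algebra_simps)
  have gb: "g b1 = b1" "g b2 = b2" "g b3 = b3"
    unfolding defs by (simp_all add: gs g gG const)
  have hb: "h b1 = b1" "h b2 = b2" "h b3 = b3"
    unfolding defs by (simp_all add: hs h hG const)
  have sb: "s b1 = b2" "s b2 = b3" "s b3 = b1"
    unfolding defs by (simp_all add: ss s sG const)
  show ?thesis
    using p_sq_F U unfolding F_def
    by (intro rational_if_biquadratic_over_cyclic[OF subfield_k indep _ _ _ g(1) gb g(2,4) h(1) hb h(2) s(1) sb p_nz(1,2) two]) auto
qed

end


section \<open>Embeddings and the degree condition\<close>

lemma
  assumes k: "subfield k" and phi: "emb_on k phi"
  shows emb_on_inj: "x \<in> k \<Longrightarrow> phi x = 0 \<Longrightarrow> x = 0"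
    and emb_on_subfield: "subfield (phi ` k)"
    and emb_on_uminus: "x \<in> k \<Longrightarrow> phi (- x) = - phi x"
proof -
  have add: "phi (x + y) = phi x + phi y" and mult: "phi (x * y) = phi x * phi y"
    if "x \<in> k" "y \<in> k" for x y using phi that by (auto simp: emb_on_def)
  have one: "phi 1 = 1" using phi by (simp add: emb_on_def)
  have "phi 0 + phi 0 = phi 0 + 0" using add[of 0 0] k by (metis add_0 add_0_right subfield_0)
  then have zero: "phi 0 = 0" by (simp only: add_left_cancel)
  have inv: "phi x * phi (inverse x) = 1" if "x \<in> k" "x \<noteq> 0" for x
    using mult[of x "inverse x"] that one k by (simp add: subfield_inverse)
  show "x \<in> k \<Longrightarrow> phi x = 0 \<Longrightarrow> x = 0" using inv[of x] by auto
  show um: "phi (- x) = - phi x" if "x \<in> k" for x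
    using add[of x "- x"] that zero k by (simp add: subfield_uminus eq_neg_iff_add_eq_0 add.commute)
  have "inverse (phi x) = phi (inverse x)" if "x \<in> k" for x
    using inv[OF that] zero by (cases "x = 0") (auto intro: inverse_unique)
  then show "subfield (phi ` k)"
    unfolding subfield_def
    using zero one k by (auto simp: add[symmetric] mult[symmetric] um[symmetric] intro!: imageI subfield_closed)
qed

text \<open>In a space spanned by two elements, 1, s and i are linearly dependent over
  \<open>phi\<close> k\<open>. Each shape of the relation puts i, s or s i into\<close>phi
  \<open>k\<close>, and squaring gives a square root of -1, a or -a.\<close>

lemma degree_le_2_cases:
  fixes k :: "'a::field set" and phi :: "'a \<Rightarrow> 'b::field"
  assumes k: "subfield k" and two: "(2::'a) \<noteq> 0" and phi: "emb_on k phi" and a: "a \<in> k"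
    and s: "s ^ 2 = phi a" and i: "i ^ 2 = -1"
    and dim: "dim_le2 (phi ` k) (gen_field (phi ` k) {s, i})"
  shows "(\<exists>j\<in>k. j ^ 2 = -1) \<or> (\<exists>b\<in>k. b ^ 2 = a) \<or> (\<exists>b\<in>k. b ^ 2 = - a)"
proof -
  let ?k = "phi ` k"
  note k' = emb_on_subfield[OF k phi]
  have mult: "phi (x * y) = phi x * phi y" and add: "phi (x + y) = phi x + phi y"
    if "x \<in> k" "y \<in> k" for x y using phi that by (auto simp: emb_on_def)
  have one: "phi 1 = 1" using phi by (simp add: emb_on_def)
  have phi_eq: "x = y" if "x \<in> k" "y \<in> k" "phi x = phi y" for x y
  proof -
    have "phi (x - y) = 0"
      using add[of x "- y"] that emb_on_uminus[OF k phi that(2)] k by (simp add: subfield_uminus)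
    then show ?thesis using emb_on_inj[OF k phi, of "x - y"] that k by (simp add: subfield_diff)
  qed
  have "phi 2 \<noteq> 0" using emb_on_inj[OF k phi subfield_numeral[OF k]] two by blast
  then have two': "(2::'b) \<noteq> 0" using add[of 1 1] one k by simp
  have sq: "\<exists>b\<in>k. b ^ 2 = d" if "t \<in> ?k" "t ^ 2 = phi d" "d \<in> k" for t d
  proof -
    from that(1) obtain b where b: "b \<in> k" "t = phi b" by blast
    have "phi (b ^ 2) = phi d" using that b by (simp add: power2_eq_square mult)
    then show ?thesis using phi_eq[of "b ^ 2" d] that b k by (auto simp: subfield_power)
  qed
  have m1: "phi (- 1) = - 1" using emb_on_uminus[OF k phi, of 1] one k by simp
  obtain b1 b2 where b: "\<And>y. y \<in> gen_field ?k {s, i} \<Longrightarrow> \<exists>c1\<in>?k. \<exists>c2\<in>?k. y = c1 * b1 + c2 * b2"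
    using dim unfolding dim_le2_def by blast
  have span: "y \<in> fspan ?k {b1, b2}" if "y \<in> gen_field ?k {s, i}" for y
  proof -
    from b[OF that] obtain c1 c2 where "c1 \<in> ?k" "c2 \<in> ?k" and y: "y = c1 * b1 + c2 * b2" by blast
    then show ?thesis unfolding y
      by (intro fspan_add[OF k'] fspan_scale[OF k' _ fspan_base[OF k']]) auto
  qed
  \<comment> \<open>The family is indexed by 0, 1, 2 and not taken as a set, so coincidences such as
    s = i do no harm.\<close>
  define z where "z = (\<lambda>n::nat. if n = 0 then 1 else if n = 1 then s else i)"
  have "z n \<in> fspan ?k {b1, b2}" for n
    unfolding z_def using subfield_1[OF subfield_gen_field] by (auto intro!: span intro: gen_field_gen)
  moreover have "card {b1, b2} < card {0, 1, 2::nat}" by (simp add: card_insert_if)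
  ultimately obtain c where c: "\<forall>n\<in>{0, 1, 2::nat}. c n \<in> ?k" "\<exists>n\<in>{0, 1, 2}. c n \<noteq> 0"
    "(\<Sum>n\<in>{0, 1, 2}. c n * z n) = 0"
    using fspan_dependent[OF k', of "{b1, b2}" "{0, 1, 2}" z] by auto
  have rel: "c 0 + c 1 * s + c 2 * i = 0" using c(3) by (simp add: z_def add.assoc)
  have c': "c 0 \<in> ?k" "c 1 \<in> ?k" "c 2 \<in> ?k" using c(1) by auto
  have solve: "x \<in> ?k" if "v * x = u" "v \<noteq> 0" "u \<in> ?k" "v \<in> ?k" for u v x
  proof -
    have "x = u / v" using that by (simp add: nonzero_eq_divide_eq mult.commute)
    then show ?thesis using that k' by (simp add: subfield_divide)
  qed
  have "i \<in> ?k \<or> s \<in> ?k \<or> s * i \<in> ?k"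
  proof (cases "c 1 = 0")
    case True
    then have "c 2 \<noteq> 0" using c(2) rel by auto
    moreover have "c 2 * i = - c 0" using rel True by (simp add: eq_neg_iff_add_eq_0 add.commute)
    ultimately show ?thesis using solve c' k' by (metis subfield_uminus)
  next
    case c1: False
    have s_eq: "c 1 * s = - (c 0 + c 2 * i)" using rel by algebra
    show ?thesis
    proof (cases "c 0 = 0 \<or> c 2 = 0")
      case True
      then show ?thesis
      proof
        assume "c 2 = 0"
        then have "c 1 * s = - c 0" using s_eq by simp
        then show ?thesis using solve c1 c' k' by (metis subfield_uminus)
      next
        assume "c 0 = 0"
        then have "c 1 * (s * i) = - (c 2 * i ^ 2)" using s_eq by (simp add: power2_eq_square flip: mult.assoc)
        then have "c 1 * (s * i) = c 2" using i by simp
        then show ?thesis using solve c1 c' by metis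
      qed
    next
      case False
      have "(c 1)^2 * s^2 = (c 0)^2 + 2 * c 0 * c 2 * i + (c 2)^2 * i^2"
        using s_eq by algebra
      then have "(2 * c 0 * c 2) * i = (c 1)^2 * phi a - (c 0)^2 + (c 2)^2" unfolding s i by simp
      moreover have "2 * c 0 * c 2 \<noteq> 0" using False two' by simp
      moreover have "(c 1)^2 * phi a - (c 0)^2 + (c 2)^2 \<in> ?k" "2 * c 0 * c 2 \<in> ?k"
        using c' a by (auto intro!: subfield_closed[OF k'])
      ultimately show ?thesis using solve by blast
    qed
  qed
  then consider "i \<in> ?k" | "s \<in> ?k" | "s * i \<in> ?k" by blast
  then show ?thesis
  proof cases
    case 1
    then show ?thesis using sq[of i "- 1"] i m1 k by (auto simp: subfield_uminus)
  next
    case 2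
    then show ?thesis using sq[of s a] s a by blast
  next
    case 3
    have "(s * i) ^ 2 = phi (- a)" using s i a by (simp add: power_mult_distrib emb_on_uminus[OF k phi])
    then show ?thesis using sq[of "s * i" "- a"] 3 a k by (auto simp: subfield_uminus)
  qed
qed

section \<open>The case of sign -1\<close>

locale minus_action = specialisation k "[x1, x2, x3]" "[x1, x1, x1]"
  for k :: "'a::field set" and x1 x2 x3 +
  fixes a :: 'a and tau lam sig :: "'a \<Rightarrow> 'a"
  assumes two: "(2::'a) \<noteq> 0" and gen_x: "gen_field k {x1, x2, x3} = UNIV"
    and a: "a \<in> k" "a \<noteq> 0"
    and tau: "k_aut k tau" "tau x1 = a / x1" "tau x2 = - (a / x2)" "tau x3 = - x3"
    and lam: "k_aut k lam" "lam x1 = - (a / x1)" "lam x2 = - x2" "lam x3 = a / x3"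
    and sig: "k_aut k sig" "sig x1 = x2" "sig x2 = x3" "sig x3 = x1"
begin

lemma spec_x: "spec x1 x1" "spec x2 x1" "spec x3 x1"
  using spec_var[of 0] spec_var[of 1] spec_var[of 2] by simp_all

lemma x_poly_nonzero: assumes "x \<in> {x1, x2, x3}"
  shows "x \<noteq> 0" "x * x + a \<noteq> 0" "x * x - a \<noteq> 0"
proof -
  have 0: "x1 \<noteq> 0"
    using alg_indep_Cons_poly_nonzero[OF subfield_k indep, of "[:0, 1:]"] subfield_k
    by (simp add: polys_over_pCons polys_over_0)
  have 1: "x1 * x1 + a \<noteq> 0"
    using alg_indep_Cons_poly_nonzero[OF subfield_k indep, of "[:a, 0, 1:]"] subfield_k a
    by (simp add: polys_over_pCons polys_over_0 add.commute)
  have 2: "x1 * x1 - a \<noteq> 0"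
    using alg_indep_Cons_poly_nonzero[OF subfield_k indep, of "[:- a, 0, 1:]"] subfield_k a
    by (simp add: polys_over_pCons polys_over_0 subfield_uminus)
  have x: "spec x x1" using spec_x assms by auto
  show "x \<noteq> 0" using spec_nonzero[OF x 0] .
  show "x * x + a \<noteq> 0" by (rule spec_nonzero[OF _ 1]) (intro spec_intros x spec_const a)
  show "x * x - a \<noteq> 0" by (rule spec_nonzero[OF _ 2]) (intro spec_intros x spec_const a)
qed

lemmas x_nz = x_poly_nonzero[of x1, simplified] x_poly_nonzero[of x2, simplified] x_poly_nonzero[of x3, simplified]

lemma rational_if_sqrt_minus_one:
  assumes j: "j \<in> k" "j ^ 2 = -1"
  shows "k_rational k {y. tau y = y \<and> lam y = y \<and> sig y = y}"
proof -
  define P where "P x = x + a / x" for x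
  define Q where "Q x = j * (x - a / x)" for x
  have four: "(4::'a) \<noteq> 0" using two by (metis mult_2 mult_eq_0_iff numeral_Bit0)
  note kc = subfield_closed[OF subfield_k]
  have circ: "P x ^ 2 + Q x ^ 2 = 4 * a" if "x \<noteq> 0" for x
  proof -
    have "P x ^ 2 + Q x ^ 2 = (x + a / x)^2 + j^2 * (x - a / x)^2" by (simp add: P_def Q_def power_mult_distrib)
    also have "\<dots> = 4 * a" unfolding j using that by (simp add: field_simps power2_eq_square)
    finally show ?thesis .
  qed
  have xg: "x \<in> gen_field k {P x, Q x}" if "x \<noteq> 0" for x
  proof -
    have "j * Q x = j^2 * (x - a / x)" by (simp add: Q_def power2_eq_square)
    then have e: "(P x - j * Q x) / 2 = x" unfolding j using two by (simp add: P_def flip: mult_2)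
    have "(P x - j * Q x) / 2 \<in> gen_field k {P x, Q x}"
      using j by (intro subfield_closed[OF subfield_gen_field]) (auto intro: gen_field_gen gen_field_base)
    then show ?thesis unfolding e .
  qed
  have sp: "spec (P x) (P x1)" "spec (Q x) (Q x1)" if "spec x x1" for x
    unfolding P_def Q_def using x_nz(1) by (auto intro!: spec_intros that spec_const a j)
  have hom: "f (P x) = P (f x)" "f (Q x) = Q (f x)" if "k_aut k f" for f x
    unfolding P_def Q_def by (simp_all add: k_aut_simps[OF that] a j)
  have sgn: "P (- x) = - P x" "Q (- x) = - Q x" for x
    by (simp_all add: P_def Q_def algebra_simps)
  have invt: "P (a / x) = P x" "Q (a / x) = - Q x" if "x \<noteq> 0" for x
    using that a by (simp_all add: P_def Q_def algebra_simps)
  \<comment> \<open>The coordinates of the rational point come from 4a = u^2 - v^2 with u + v = 4a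
    and u - v = 1; since j^2 = -1, this is u^2 + (j v)^2.\<close>
  interpret circle_action k x1 x2 x3 "P x1" "P x2" "P x3" "Q x1" "Q x2" "Q x3" "4 * a"
    "(4 * a + 1) / 2" "j * (4 * a - 1) / 2" tau lam sig
  proof unfold_locales
    define v where "v = (4 * a - 1) / 2"
    have v: "(4 * a + 1) / 2 = v + 1" "j * (4 * a - 1) / 2 = j * v" "2 * v = 4 * a - 1"
      using two by (simp_all add: v_def field_simps)
    have "(v + 1)\<^sup>2 + (j * v)\<^sup>2 = 2 * v + 1" using j(2) by algebra
    then show "((4 * a + 1) / 2)\<^sup>2 + (j * (4 * a - 1) / 2)\<^sup>2 = 4 * a" unfolding v by simp
    show "4 * a \<in> k" "(4 * a + 1) / 2 \<in> k" "j * (4 * a - 1) / 2 \<in> k" using a j by (auto intro!: kc)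
  qed (use x_nz two four gen_x a circ xg sp spec_x hom[OF tau(1)] hom[OF lam(1)] hom[OF sig(1)] tau lam sig sgn invt in auto)
  show ?thesis by (rule fixed_field_rational)
qed

lemma rational_if_sqrt:
  assumes b: "b \<in> k" "b ^ 2 = a"
  shows "k_rational k {y. tau y = y \<and> lam y = y \<and> sig y = y}"
proof -
  \<comment> \<open>The standard parametrisation of the unit circle by t = x/b, with the two
    coordinates (t^2 - 1)/(t^2 + 1) and 2 t/(t^2 + 1).\<close>
  define P where "P x = (x * x - a) / (x * x + a)" for x
  define Q where "Q x = 2 * b * x / (x * x + a)" for x
  have circ: "P x ^ 2 + Q x ^ 2 = 1" if "x * x + a \<noteq> 0" for x
  proof -
    have "(x * x - a)^2 + (2 * b * x)^2 = (x * x + a)^2" unfolding b(2)[symmetric] by algebra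
    then show ?thesis using that by (simp add: P_def Q_def power_divide add_divide_distrib[symmetric])
  qed
  have b0: "b \<noteq> 0" using a b by auto
  have xg: "x \<in> gen_field k {P x, Q x}" if "x * x + a \<noteq> 0" for x
  proof -
    have "1 - P x = 2 * b * b / (x * x + a)" using that b by (simp add: P_def field_simps power2_eq_square)
    then have "b * Q x / (1 - P x) = x" using that b0 two by (simp add: Q_def)
    moreover have "b * Q x / (1 - P x) \<in> gen_field k {P x, Q x}"
      using b by (intro subfield_closed[OF subfield_gen_field]) (auto intro: gen_field_gen gen_field_base)
    ultimately show ?thesis by simp
  qed
  have sp: "spec (P x) (P x1)" "spec (Q x) (Q x1)" if "spec x x1" for x
    unfolding P_def Q_def mult.assoc[of 2] using x_nz
    by (auto intro!: spec_intros that spec_const[OF a(1)] spec_const[OF b(1)])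
  have hom: "f (P x) = P (f x)" "f (Q x) = Q (f x)" if "k_aut k f" for f x
    unfolding P_def Q_def by (simp_all add: k_aut_simps[OF that] a b)
  have sgn: "P (- x) = P x" "Q (- x) = - Q x" for x
    by (simp_all add: P_def Q_def)
  have invt: "P (a / x) = - P x" "Q (a / x) = Q x" if "x \<noteq> 0" "x * x + a \<noteq> 0" for x
  proof -
    have "(a / x) * (a / x) - a = - (a / (x * x)) * (x * x - a)" "(a / x) * (a / x) + a = (a / (x * x)) * (x * x + a)"
      "2 * b * (a / x) = (a / (x * x)) * (2 * b * x)"
      using that by (simp_all add: field_simps)
    then show "P (a / x) = - P x" "Q (a / x) = Q x"
      unfolding P_def Q_def using that a by simp_all
  qed
  have rho: "k_aut k (tau \<circ> lam)" using k_aut_comp[OF tau(1) lam(1)] .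
  \<comment> \<open>Negation of x now changes only the sign of Q, and inversion only that of P. The
    prescribed sign pattern is therefore realised by another pair of generators of V:
    \<open>tau \<circ> lam\<close> negates x1 and inverts x2, and \<open>tau\<close> inverts x1 and
    negates x3.\<close>
  interpret circle_action k x1 x2 x3 "P x1" "P x2" "P x3" "Q x1" "Q x2" "Q x3" 1 1 0 "tau \<circ> lam" tau sig
    by unfold_locales (use subfield_k x_nz two gen_x a circ xg sp spec_x rho hom[OF tau(1)] hom[OF lam(1)] hom[OF sig(1)] tau lam sig sgn invt in
      \<open>auto simp: k_aut_uminus[OF tau(1)]\<close>)
  have "{y. (tau \<circ> lam) y = y \<and> tau y = y \<and> sig y = y} = {y. tau y = y \<and> lam y = y \<and> sig y = y}"
  proof -
    have "inj tau" using tau(1) by (simp add: k_aut_def bij_def)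
    then have "tau (lam y) = y \<and> tau y = y \<longleftrightarrow> tau y = y \<and> lam y = y" for y by (metis injD)
    then show ?thesis by auto
  qed
  then show ?thesis using fixed_field_rational by simp
qed

lemma rational_if_sqrt_minus:
  assumes b: "b \<in> k" "b ^ 2 = - a"
  shows "k_rational k {y. tau y = y \<and> lam y = y \<and> sig y = y}"
proof -
  \<comment> \<open>Again the unit circle at t = x/b, now with b^2 = -a and the coordinates
    interchanged; x -> a/x becomes t -> -1/t and negates both of them.\<close>
  define P where "P x = 2 * b * x / (x * x - a)" for x
  define Q where "Q x = (x * x + a) / (x * x - a)" for x
  have ab: "a = - (b * b)" using b by (simp add: power2_eq_square)
  have circ: "P x ^ 2 + Q x ^ 2 = 1" if "x * x - a \<noteq> 0" for x
  proof -
    have "(2 * b * x)^2 + (x * x + a)^2 = (x * x - a)^2" unfolding ab by algebra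
    then show ?thesis using that by (simp add: P_def Q_def power_divide add_divide_distrib[symmetric])
  qed
  have b0: "b \<noteq> 0" using a b by auto
  have xg: "x \<in> gen_field k {P x, Q x}" if "x * x - a \<noteq> 0" for x
  proof -
    have "1 - Q x = 2 * b * b / (x * x - a)" using that by (simp add: Q_def field_simps) (simp add: ab)
    then have "b * P x / (1 - Q x) = x" using that b0 two by (simp add: P_def)
    moreover have "b * P x / (1 - Q x) \<in> gen_field k {P x, Q x}"
      using b by (intro subfield_closed[OF subfield_gen_field]) (auto intro: gen_field_gen gen_field_base)
    ultimately show ?thesis by simp
  qed
  have sp: "spec (P x) (P x1)" "spec (Q x) (Q x1)" if "spec x x1" for x
    unfolding P_def Q_def mult.assoc[of 2] using x_nz
    by (auto intro!: spec_intros that spec_const[OF a(1)] spec_const[OF b(1)])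
  have hom: "f (P x) = P (f x)" "f (Q x) = Q (f x)" if "k_aut k f" for f x
    unfolding P_def Q_def by (simp_all add: k_aut_simps[OF that] a b)
  have sgn: "P (- x) = - P x" "Q (- x) = Q x" for x
    by (simp_all add: P_def Q_def)
  have invt: "P (a / x) = - P x" "Q (a / x) = - Q x" if "x \<noteq> 0" "x * x - a \<noteq> 0" for x
  proof -
    have "(a / x) * (a / x) - a = - (a / (x * x)) * (x * x - a)" "(a / x) * (a / x) + a = (a / (x * x)) * (x * x + a)"
      "2 * b * (a / x) = (a / (x * x)) * (2 * b * x)"
      using that by (simp_all add: field_simps)
    then show "P (a / x) = - P x" "Q (a / x) = - Q x"
      unfolding P_def Q_def using that a by simp_all
  qed
  have rho: "k_aut k (tau \<circ> lam)" using k_aut_comp[OF tau(1) lam(1)] .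
  interpret circle_action k x1 x2 x3 "P x1" "P x2" "P x3" "Q x1" "Q x2" "Q x3" 1 1 0 lam "tau \<circ> lam" sig
    by unfold_locales (use subfield_k x_nz two gen_x a circ xg sp spec_x rho hom[OF tau(1)] hom[OF lam(1)] hom[OF sig(1)] tau lam sig sgn invt in
      \<open>auto simp: k_aut_uminus[OF tau(1)]\<close>)
  have "{y. lam y = y \<and> (tau \<circ> lam) y = y \<and> sig y = y} = {y. tau y = y \<and> lam y = y \<and> sig y = y}"
    by auto
  then show ?thesis using fixed_field_rational by simp
qed

end

text \<open>Square roots of a and -1 need not exist in the given field, so the degree condition is
  stated in a second field, into which k is embedded by \<open>phi\<close>.\<close>

theorem theorem1p7:
  fixes k :: "'K::field set" and x1 x2 x3 a eps :: 'K
    and tau lam sig :: "'K \<Rightarrow> 'K"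
  assumes "subfield k"
    and "(2::'K) \<noteq> 0"
    and "alg_indep k [x1, x2, x3]"
    and "gen_field k {x1, x2, x3} = UNIV"
    and "a \<in> k" and "a \<noteq> 0"
    and "k_aut k tau" and "tau x1 = a / x1" and "tau x2 = eps * (a / x2)" and "tau x3 = eps * x3"
    and "k_aut k lam" and "lam x1 = eps * (a / x1)" and "lam x2 = eps * x2" and "lam x3 = a / x3"
    and "k_aut k sig" and "sig x1 = x2" and "sig x2 = x3" and "sig x3 = x1"
    and "eps = 1 \<or>
         (eps = -1 \<and> (\<exists>(phi :: 'K \<Rightarrow> 'E::field) s i. emb_on k phi \<and> s ^ 2 = phi a \<and> i ^ 2 = -1
              \<and> dim_le2 (phi ` k) (gen_field (phi ` k) {s, i})))"
  shows "k_rational k {y. tau y = y \<and> lam y = y \<and> sig y = y}"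
  using assms(19)
proof
  assume "eps = 1"
  then show ?thesis using assms
    by (intro fixed_field_rational_plus[OF assms(1-6) assms(7) _ _ _ assms(11) _ _ _ assms(15-18)]) auto
next
  assume *: "eps = -1 \<and> (\<exists>(phi :: 'K \<Rightarrow> 'E::field) s i. emb_on k phi \<and> s ^ 2 = phi a \<and> i ^ 2 = -1
              \<and> dim_le2 (phi ` k) (gen_field (phi ` k) {s, i}))"
  then obtain phi :: "'K \<Rightarrow> 'E" and s i where "emb_on k phi" "s ^ 2 = phi a" "i ^ 2 = -1"
    "dim_le2 (phi ` k) (gen_field (phi ` k) {s, i})" by blast
  note cases = degree_le_2_cases[OF assms(1,2) this(1) assms(5) this(2-4)]
  interpret minus_action k x1 x2 x3 a tau lam sig
    by unfold_locales (use assms * in auto)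
  show ?thesis
    using cases rational_if_sqrt_minus_one rational_if_sqrt rational_if_sqrt_minus by blast
qed

end
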